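(* Let $u\in L^2_\mu(\mathcal X)$, let $M\ge 1$ be an integer, let $\delta\in(0,1)$ and $\eta\in(0,1)$, and assume $n\ge n(\delta,\eta,m):=d_\delta^{-1}\,m\log(2m\eta^{-1})$, where $d_\delta=-\delta+(1+\delta)\log(1+\delta)$. Let $\widetilde{\bm x}^n$ be a random sample following the distribution $\widetilde{\bm\rho}^n$ (best of $M$ independent $n$-samples, conditioned on $\delta$-stability; see context). Then the weighted least-squares projection $Q_{V_m}^{\widetilde{\bm x}^n}u$ satisfies $$\mathbb E\big(\|u-Q_{V_m}^{\widetilde{\bm x}^n}u\|^2\big)\le \big(1+(1-\delta)^{-1}(1-\eta^M)^{-1}M\big)\,\|u-P_{V_m}u\|^2 .$$ Moreover, if $\|u\|_{\infty,w}\le L$, then $$\mathbb E\big(\|u-Q_{V_m}^{\widetilde{\bm x}^n}u\|^2\big)\le \|u-P_{V_m}u\|^2+(1-\delta)^{-1}(1-\eta^M)^{-1}D\big(M,L,m,\|u-P_{V_m}u\|^2\big),$$ where, for all $\alpha\ge 0$, $$D(M,L,m,\alpha)=\inf_{0<\varepsilon\le 1} C(\varepsilon,M)\,\big(L(1+c_m)\big)^{2-2\varepsilon}\alpha^{\varepsilon},\qquad C(\varepsilon,M)=M\frac{(1-\varepsilon)^{1-\varepsilon}}{(M-\varepsilon)^{1-\varepsilon}}$$ (with $C(1,M)=M$), and $c_m$ is the supremum of $\|P_{V_m}v\|_{\infty,w}$ over functions $v\in L^2_\mu(\mathcal X)$ with $\|v\|_{\infty,w}\le 1$.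
   Context: Setting: $\mathcal X\subset\mathbb R^d$ is equipped with a probability measure $\mu$; $L^2_\mu(\mathcal X)$ is the space of square-integrable real-valued functions, with norm $\|\cdot\|$ and inner product $(\cdot,\cdot)$; functions are regarded as defined pointwise. $V_m\subset L^2_\mu(\mathcal X)$ is a subspace of dimension $m\ge1$ with orthonormal basis $\varphi_1,\dots,\varphi_m$, and $\bm\varphi(x)=(\varphi_1(x),\dots,\varphi_m(x))^T$. $P_{V_m}v=\sum_j (v,\varphi_j)\varphi_j$ is the $L^2_\mu$-orthogonal projection onto $V_m$. Weight: $w$ is defined by $w(x)^{-1}=\frac1m\sum_{j=1}^m\varphi_j(x)^2$ (where this vanishes, set $w(x)=0$). $\rho$ is the probability measure $d\rho=w^{-1}d\mu$ and $\bm\rho^n=\rho^{\otimes n}$. $\|v\|_{\infty,w}=\sup_{x\in\mathcal X}w(x)^{1/2}|v(x)|$. For a sample $\bm x^n=(x^1,\dots,x^n)\in\mathcal X^n$: $\|v\|_{\bm x^n}^2=\frac1n\sum_{i=1}^n w(x^i)v(x^i)^2$; $\bm G_{\bm x^n}=\frac1n\sum_{i=1}^n w(x^i)\bm\varphi(x^i)\bm\varphi(x^i)^T$; $Z_{\bm x^n}=\|\bm G_{\bm x^n}-\bm I\|_2$ (spectral norm); $Q^{\bm x^n}_{V_m}u=\arg\min_{v\in V_m}\|u-v\|_{\bm x^n}$ (unique when $Z_{\bm x^n}<1$). Sampling: draw $M$ independent samples $\bm x^{n,1},\dots,\bm x^{n,M}$ from $\bm\rho^n$, and let $\bm x^{n,\star}$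 be one of them minimizing $Z_{\bm x^{n,i}}$ over $1\le i\le M$, chosen uniformly at random among the minimizers in case of ties. $\widetilde{\bm\rho}^n$ is the distribution of $\bm x^{n,\star}$ conditioned on the event $A_\delta=\{Z_{\bm x^{n,\star}}\le\delta\}$. *)

theory Defs
  imports "HOL-Probability.Probability"
begin

(* The domain is the space of mu.  The basis of V_m is indexed by a finite type 'm, so that
   m = CARD('m) and m-by-m matrices have type real^'m^'m.  Functions are not identified
   up to null sets, since they are evaluated at sample points. *)

definition L2 :: "'a measure \<Rightarrow> ('a \<Rightarrow> real) set" where
  "L2 \<mu> = {v \<in> borel_measurable \<mu>. integrable \<mu> (\<lambda>x. (v x)\<^sup>2)}"

definition L2_inner :: "'a measure \<Rightarrow> ('a \<Rightarrow> real) \<Rightarrow> ('a \<Rightarrow> real) \<Rightarrow> real" where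
  "L2_inner \<mu> u v = (LINT x|\<mu>. u x * v x)"

definition L2_norm :: "'a measure \<Rightarrow> ('a \<Rightarrow> real) \<Rightarrow> real" where
  "L2_norm \<mu> v = sqrt (L2_inner \<mu> v v)"

definition L2_orthonormal :: "'a measure \<Rightarrow> ('m::finite \<Rightarrow> 'a \<Rightarrow> real) \<Rightarrow> bool" where
  "L2_orthonormal \<mu> \<phi> \<longleftrightarrow>
     (\<forall>j. \<phi> j \<in> L2 \<mu>) \<and> (\<forall>i j. L2_inner \<mu> (\<phi> i) (\<phi> j) = (if i = j then 1 else 0))"

definition fspan :: "('m::finite \<Rightarrow> 'a \<Rightarrow> real) \<Rightarrow> ('a \<Rightarrow> real) set" where
  "fspan \<phi> = {v. \<exists>c :: 'm \<Rightarrow> real. v = (\<lambda>x. \<Sum>j\<in>UNIV. c j * \<phi> j x)}"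

definition L2_proj :: "'a measure \<Rightarrow> ('m::finite \<Rightarrow> 'a \<Rightarrow> real) \<Rightarrow> ('a \<Rightarrow> real) \<Rightarrow> 'a \<Rightarrow> real" where
  "L2_proj \<mu> \<phi> v = (\<lambda>x. \<Sum>j\<in>UNIV. L2_inner \<mu> v (\<phi> j) * \<phi> j x)"

definition inv_weight :: "('m::finite \<Rightarrow> 'a \<Rightarrow> real) \<Rightarrow> 'a \<Rightarrow> real" where
  "inv_weight \<phi> x = (\<Sum>j\<in>UNIV. (\<phi> j x)\<^sup>2) / real CARD('m)"

definition weight :: "('m::finite \<Rightarrow> 'a \<Rightarrow> real) \<Rightarrow> 'a \<Rightarrow> real" where
  "weight \<phi> x = (if inv_weight \<phi> x = 0 then 0 else 1 / inv_weight \<phi> x)"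

definition sampling_measure :: "'a measure \<Rightarrow> ('m::finite \<Rightarrow> 'a \<Rightarrow> real) \<Rightarrow> 'a measure" where
  "sampling_measure \<mu> \<phi> = density \<mu> (\<lambda>x. ennreal (inv_weight \<phi> x))"

definition sample_measure ::
    "'a measure \<Rightarrow> ('m::finite \<Rightarrow> 'a \<Rightarrow> real) \<Rightarrow> nat \<Rightarrow> (nat \<Rightarrow> 'a) measure" where
  "sample_measure \<mu> \<phi> n = PiM {1..n} (\<lambda>_. sampling_measure \<mu> \<phi>)"

(* A genuine pointwise supremum over the domain, possibly infinite. *)
definition wsup_norm ::
    "'a measure \<Rightarrow> ('m::finite \<Rightarrow> 'a \<Rightarrow> real) \<Rightarrow> ('a \<Rightarrow> real) \<Rightarrow> ereal" where
  "wsup_norm \<mu> \<phi> v = (SUP x\<in>space \<mu>. ereal (sqrt (weight \<phi> x) * \<bar>v x\<bar>))"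

(* The supremum is at most sqrt m when phi is orthonormal and mu is a probability measure,
   so real_of_ereal loses nothing. *)
definition proj_const :: "'a measure \<Rightarrow> ('m::finite \<Rightarrow> 'a \<Rightarrow> real) \<Rightarrow> real" where
  "proj_const \<mu> \<phi> =
     real_of_ereal (SUP v\<in>{v \<in> L2 \<mu>. wsup_norm \<mu> \<phi> v \<le> 1}. wsup_norm \<mu> \<phi> (L2_proj \<mu> \<phi> v))"

definition emp_norm ::
    "('m::finite \<Rightarrow> 'a \<Rightarrow> real) \<Rightarrow> nat \<Rightarrow> (nat \<Rightarrow> 'a) \<Rightarrow> ('a \<Rightarrow> real) \<Rightarrow> real" where
  "emp_norm \<phi> n x v = sqrt ((\<Sum>i=1..n. weight \<phi> (x i) * (v (x i))\<^sup>2) / real n)"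

definition emp_gram :: "('m::finite \<Rightarrow> 'a \<Rightarrow> real) \<Rightarrow> nat \<Rightarrow> (nat \<Rightarrow> 'a) \<Rightarrow> real^'m^'m" where
  "emp_gram \<phi> n x =
     (\<chi> j k. (\<Sum>i=1..n. weight \<phi> (x i) * \<phi> j (x i) * \<phi> k (x i)) / real n)"

definition gram_dev :: "('m::finite \<Rightarrow> 'a \<Rightarrow> real) \<Rightarrow> nat \<Rightarrow> (nat \<Rightarrow> 'a) \<Rightarrow> real" where
  "gram_dev \<phi> n x = onorm (\<lambda>a. (emp_gram \<phi> n x - mat 1) *v a)"

(* The minimiser is unique when gram_dev is below 1; otherwise an arbitrary one is chosen. *)
definition ls_proj ::
    "('m::finite \<Rightarrow> 'a \<Rightarrow> real) \<Rightarrow> nat \<Rightarrow> (nat \<Rightarrow> 'a) \<Rightarrow> ('a \<Rightarrow> real) \<Rightarrow> 'a \<Rightarrow> real" where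
  "ls_proj \<phi> n x u = arg_min_on (\<lambda>v. emp_norm \<phi> n x (\<lambda>t. u t - v t)) (fspan \<phi>)"

(* Here \<omega> i is the i-th n-point sample. *)
definition best_indices ::
    "('m::finite \<Rightarrow> 'a \<Rightarrow> real) \<Rightarrow> nat \<Rightarrow> nat \<Rightarrow> (nat \<Rightarrow> nat \<Rightarrow> 'a) \<Rightarrow> nat set" where
  "best_indices \<phi> n M \<omega> = {i. is_arg_min (\<lambda>i. gram_dev \<phi> n (\<omega> i)) (\<lambda>i. i \<in> {1..M}) i}"

(* Law of the best of M independent samples: draw \<omega>, then draw i uniformly from the set of
   minimising indices, and return \<omega> i. *)
definition best_sample_measure ::
    "'a measure \<Rightarrow> ('m::finite \<Rightarrow> 'a \<Rightarrow> real) \<Rightarrow> nat \<Rightarrow> nat \<Rightarrow> (nat \<Rightarrow> 'a) measure" where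
  "best_sample_measure \<mu> \<phi> n M =
     Giry_Monad.bind (PiM {1..M} (\<lambda>_. sample_measure \<mu> \<phi> n))
       (\<lambda>\<omega>. distr (measure_pmf (pmf_of_set (best_indices \<phi> n M \<omega>)))
                    (sample_measure \<mu> \<phi> n) (\<lambda>i. \<omega> i))"

(* uniform_measure N A is N conditioned on the event A. *)
definition stable_sample_measure ::
    "'a measure \<Rightarrow> ('m::finite \<Rightarrow> 'a \<Rightarrow> real) \<Rightarrow> nat \<Rightarrow> nat \<Rightarrow> real \<Rightarrow> (nat \<Rightarrow> 'a) measure" where
  "stable_sample_measure \<mu> \<phi> n M \<delta> =
     uniform_measure (best_sample_measure \<mu> \<phi> n M)
       {x \<in> space (sample_measure \<mu> \<phi> n). gram_dev \<phi> n x \<le> \<delta>}"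

definition d_const :: "real \<Rightarrow> real" where
  "d_const \<delta> = - \<delta> + (1 + \<delta>) * ln (1 + \<delta>)"

(* Real power with 0^0 = 1, whereas 0 powr 0 = 0 in HOL. *)
definition rpow :: "real \<Rightarrow> real \<Rightarrow> real" where
  "rpow x a = (if a = 0 then 1 else x powr a)"

definition C_const :: "real \<Rightarrow> nat \<Rightarrow> real" where
  "C_const \<epsilon> M = real M * rpow (1 - \<epsilon>) (1 - \<epsilon>) / rpow (real M - \<epsilon>) (1 - \<epsilon>)"

lemma C_const_1: "C_const 1 M = real M"
  by (simp add: C_const_def rpow_def)

(* c stands for proj_const, the only way in which the bound depends on V_m. *)
definition D_const :: "nat \<Rightarrow> real \<Rightarrow> real \<Rightarrow> real \<Rightarrow> real" where
  "D_const M L c \<alpha> =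
     (INF \<epsilon>\<in>{0<..1}. C_const \<epsilon> M * rpow (L * (1 + c)) (2 - 2 * \<epsilon>) * rpow \<alpha> \<epsilon>)"

end

theory Submission
  imports Defs
begin

text \<open>Let \<open>g = u - P u\<close> be the residual of the orthogonal projection. If the Gram matrix \<open>G\<close> of a
  sample is within \<open>\<delta>\<close> of the identity, then \<open>G \<ge> 1 - \<delta>\<close>. The difference \<open>Q u - P u\<close> is the empirical
  projection of \<open>g\<close>, so its empirical norm is at most that of \<open>g\<close>, and its true squared norm is at
  most \<open>1 / (1 - \<delta>)\<close> times the empirical squared norm of \<open>g\<close>. With Pythagoras this bounds the error
  (\<open>ls_proj_error\<close>). It remains to find the expected empirical squared norm of \<open>g\<close> under the
  conditioned best sample.

  Conditioning costs a factor of one over the probability of stability (\<open>stable_expectation_le\<close>),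
  and the best sample is unstable only if all \<open>M\<close> independent samples are, which has probability at
  most \<open>\<eta>^M\<close>. Before conditioning, the value at the best sample is at most the sum of the values
  at all \<open>M\<close> samples, which gives the factor \<open>M\<close>. If \<open>g\<close> is bounded by \<open>B\<close> in the weighted supremum
  norm, the values divided by \<open>B\<^sup>2\<close> lie in \<open>[0, 1]\<close>; the selected one is at most one minus the product
  of the complements, whose expectation is \<open>1 - (1 - a)^M\<close> when each value has mean \<open>a\<close>. Hoelder's
  inequality turns this into \<open>C_const \<epsilon> M * a^\<epsilon>\<close> (\<open>one_minus_power_le_C_const\<close>).

  That a single sample is unstable with probability at most \<open>\<eta>\<close> is a matrix Chernoff bound
  (\<open>gram_dev_tail\<close>). The Gram matrix is the average of \<open>m\<close> times independent rank-one projections,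
  each with mean \<open>I / m\<close>. Let \<open>P\<close> be the projection onto a unit vector \<open>v\<close>, and \<open>A\<close> self-adjoint. Then
  \<open>tr e^(A + t P) \<le> tr e^A + (e^t - 1) \<langle>v, e^A v\<rangle>\<close>, the rank-one case of the Golden-Thompson inequality
  (\<open>trace_exp_rank_one_update\<close>). Averaging over \<open>v\<close>, every further summand multiplies the expected
  trace by at most \<open>1 + (e^t - 1) / m\<close>, so that Markov's inequality with \<open>t = ln (1 + \<delta>)\<close> and
  \<open>t = ln (1 - \<delta>)\<close> bounds the probabilities of a large and of a small eigenvalue by \<open>m e^(- n d_const \<delta> / m)\<close>.

  The rank-one inequality has an elementary proof. As a function of \<open>t\<close>, the left-hand side has
  derivative \<open>q t = \<langle>v, e^(A + t P) v\<rangle>\<close>, and it suffices that \<open>q' \<le> q\<close>. The derivative of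
  \<open>\<langle>v, (A + t P)^k v\<rangle>\<close> is the sum of the \<open>k\<close> products \<open>a(i) a(j)\<close> with \<open>i + j = k - 1\<close>, where \<open>a(i)\<close> is
  the \<open>i\<close>-th moment of the spectral measure of \<open>v\<close>, a probability measure. If \<open>A + t P\<close> is positive,
  Chebyshev's inequality gives \<open>a(i) a(j) \<le> a(i + j)\<close>, hence \<open>q' \<le> q\<close>; adding a multiple of the identity to \<open>A\<close> reduces
  the general case to this one.\<close>

section \<open>Eigenbases of self-adjoint maps\<close>

definition selfadjoint :: "('a::real_inner \<Rightarrow> 'a) \<Rightarrow> bool" where
  "selfadjoint f \<longleftrightarrow> linear f \<and> (\<forall>x y. f x \<bullet> y = x \<bullet> f y)"

definition eigenbasis :: "('a::euclidean_space \<Rightarrow> 'a) \<Rightarrow> 'a set \<Rightarrow> ('a \<Rightarrow> real) \<Rightarrow> bool" where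
  "eigenbasis f B l \<longleftrightarrow> finite B \<and> pairwise orthogonal B \<and> (\<forall>b\<in>B. norm b = 1) \<and> span B = UNIV
     \<and> (\<forall>b\<in>B. f b = l b *\<^sub>R b)"

lemma selfadjoint_linear: "selfadjoint f \<Longrightarrow> linear f"
  by (simp add: selfadjoint_def)

lemma selfadjoint_swap: "selfadjoint f \<Longrightarrow> f x \<bullet> y = x \<bullet> f y"
  by (simp add: selfadjoint_def)

lemma selfadjoint_funpow_swap: "selfadjoint f \<Longrightarrow> (f ^^ k) x \<bullet> y = x \<bullet> (f ^^ k) y"
proof (induction k arbitrary: x y)
  case (Suc k)
  then show ?case
    by (simp add: selfadjoint_swap funpow_swap1)
qed simp

lemma quadratic_dominates_linear_imp_zero:
  fixes a c :: real
  assumes "\<And>s. 2 * s * a \<le> s\<^sup>2 * c" and "0 \<le> a"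
  shows "a = 0"
proof (rule ccontr)
  assume "a \<noteq> 0"
  with assms have a: "0 < a" by simp
  define s where "s = a / (\<bar>c\<bar> + 1)"
  have s: "0 < s" using a by (simp add: s_def)
  have "2 * a \<le> s * c"
    using assms(1)[of s] s by (simp add: power2_eq_square)
  also have "\<dots> \<le> s * (\<bar>c\<bar> + 1)" using s by (intro mult_left_mono) auto
  also have "\<dots> = a" by (simp add: s_def)
  finally show False using a by simp
qed

text \<open>The maximiser of the Rayleigh quotient on the unit sphere of an invariant subspace is an
  eigenvector.\<close>

lemma selfadjoint_eigenvector_in_subspace:
  fixes f :: "'a::euclidean_space \<Rightarrow> 'a"
  assumes f: "selfadjoint f" and S: "subspace S" and inv: "\<And>x. x \<in> S \<Longrightarrow> f x \<in> S"
    and ne: "z \<in> S" "z \<noteq> 0"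
  obtains v l where "v \<in> S" "norm v = 1" "f v = l *\<^sub>R v"
proof -
  have lin: "linear f" using f by (rule selfadjoint_linear)
  let ?K = "S \<inter> sphere 0 1"
  have "compact ?K"
    using closed_subspace[OF S] by (intro closed_Int_compact) auto
  moreover have "(1 / norm z) *\<^sub>R z \<in> ?K"
    using ne S by (auto simp: subspace_scale)
  then have "?K \<noteq> {}" by blast
  moreover have "continuous_on ?K (\<lambda>x. x \<bullet> f x)"
    using lin by (intro continuous_on_inner continuous_on_id linear_continuous_on)
      (simp add: linear_conv_bounded_linear)
  ultimately have "\<exists>v\<in>?K. \<forall>x\<in>?K. x \<bullet> f x \<le> v \<bullet> f v"
    by (rule continuous_attains_sup)
  then obtain v where v: "v \<in> ?K" and max: "\<And>x. x \<in> ?K \<Longrightarrow> x \<bullet> f x \<le> v \<bullet> f v"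
    by blast
  define m where "m = v \<bullet> f v"
  have ray: "y \<bullet> f y \<le> m * (y \<bullet> y)" if "y \<in> S" for y
  proof (cases "y = 0")
    case False
    let ?y = "(1 / norm y) *\<^sub>R y"
    have "?y \<in> ?K" using False that S by (auto simp: subspace_scale)
    from max[OF this] have "(y \<bullet> f y) / (norm y)\<^sup>2 \<le> m"
      by (simp add: m_def linear_cmul[OF lin] power2_eq_square)
    then show ?thesis using False
      by (simp add: divide_le_eq dot_square_norm)
  qed (simp add: linear_0[OF lin])
  have vn: "v \<bullet> v = 1" "v \<in> S" using v by (auto simp: dot_square_norm)
  define w where "w = f v - m *\<^sub>R v"
  have wS: "w \<in> S" unfolding w_def using vn inv S by (intro subspace_diff subspace_scale) auto
  \<comment> \<open>A first-order variation of the Rayleigh quotient at its maximiser, in the direction of the residual.\<close>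
  have "w \<bullet> w = 0"
  proof (rule quadratic_dominates_linear_imp_zero)
    fix s :: real
    have "v + s *\<^sub>R w \<in> S" using vn wS S by (intro subspace_add subspace_scale) auto
    from ray[OF this]
    have *: "(v + s *\<^sub>R w) \<bullet> (f v + s *\<^sub>R f w) \<le> m * ((v + s *\<^sub>R w) \<bullet> (v + s *\<^sub>R w))"
      by (simp add: linear_add[OF lin] linear_cmul[OF lin])
    have "v \<bullet> f w = w \<bullet> f v" using selfadjoint_swap[OF f, of w v] by (simp add: inner_commute)
    then have "(v + s *\<^sub>R w) \<bullet> (f v + s *\<^sub>R f w) = m + 2 * s * (w \<bullet> f v) + s\<^sup>2 * (w \<bullet> f w)"
      by (simp add: inner_add_left inner_add_right m_def power2_eq_square distrib_left mult.assoc)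
    moreover have "(v + s *\<^sub>R w) \<bullet> (v + s *\<^sub>R w) = 1 + 2 * s * (w \<bullet> v) + s\<^sup>2 * (w \<bullet> w)"
      using vn inner_commute[of v w]
      by (simp add: inner_add_left inner_add_right power2_eq_square distrib_left mult.assoc)
    ultimately have "m + 2 * s * (w \<bullet> f v) + s\<^sup>2 * (w \<bullet> f w) \<le> m * (1 + 2 * s * (w \<bullet> v) + s\<^sup>2 * (w \<bullet> w))"
      using * by simp
    moreover have "w \<bullet> f v = w \<bullet> w + m * (w \<bullet> v)"
      by (simp add: w_def inner_diff)
    ultimately show "2 * s * (w \<bullet> w) \<le> s\<^sup>2 * (m * (w \<bullet> w) - w \<bullet> f w)"
      by (simp add: algebra_simps)
  qed simp
  then have "f v = m *\<^sub>R v" by (simp add: w_def)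
  with v show ?thesis by (intro that[of v m]) auto
qed

lemma orthonormal_imp_independent:
  fixes B :: "'a::euclidean_space set"
  assumes "pairwise orthogonal B" "\<forall>b\<in>B. norm b = 1"
  shows "independent B" "finite B" "card B \<le> DIM('a)"
proof -
  show i: "independent B"
    using assms by (intro pairwise_orthogonal_independent) auto
  from independent_bound[OF this] show "finite B" "card B \<le> DIM('a)" by auto
qed

text \<open>An orthonormal set of eigenvectors of maximal size spans the space, because its orthogonal
  complement is invariant and would otherwise contain a further eigenvector.\<close>

lemma selfadjoint_has_eigenbasis:
  fixes f :: "'a::euclidean_space \<Rightarrow> 'a"
  assumes f: "selfadjoint f"
  obtains B l where "eigenbasis f B l"
proof -
  define P where "P B \<longleftrightarrow> pairwise orthogonal B \<and> (\<forall>b\<in>B. norm b = 1) \<and> (\<forall>b\<in>B. \<exists>l. f b = l *\<^sub>R b)" for B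
  have "P {}" by (simp add: P_def)
  moreover have "\<forall>B. P B \<longrightarrow> card B \<le> DIM('a)"
    using orthonormal_imp_independent(3) by (auto simp: P_def)
  ultimately have "\<exists>B. P B \<and> (\<forall>C. P C \<longrightarrow> card C \<le> card B)"
    by (intro ex_has_greatest_nat[of P "{}" card "Suc DIM('a)"]) (simp_all add: less_Suc_eq_le)
  then obtain B where B: "P B" and max: "\<And>C. P C \<Longrightarrow> card C \<le> card B"
    by blast
  have fin: "finite B" using B orthonormal_imp_independent by (auto simp: P_def)
  have "span B = UNIV"
  proof (rule ccontr)
    assume "span B \<noteq> UNIV"
    then obtain z where z: "z \<noteq> 0" "\<And>x. x \<in> span B \<Longrightarrow> z \<bullet> x = 0"
      using span_not_UNIV_orthogonal by blast
    define S where "S = {x. \<forall>b\<in>B. b \<bullet> x = 0}"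
    have "subspace S" unfolding S_def subspace_def by (auto simp: inner_add)
    moreover have "f x \<in> S" if "x \<in> S" for x
    proof -
      have "b \<bullet> f x = 0" if b: "b \<in> B" for b
      proof -
        obtain l where "f b = l *\<^sub>R b" using B b by (auto simp: P_def)
        then have "b \<bullet> f x = l * (b \<bullet> x)" using selfadjoint_swap[OF f, of b x] by simp
        then show ?thesis using \<open>x \<in> S\<close> b by (simp add: S_def)
      qed
      then show ?thesis by (simp add: S_def)
    qed
    moreover have "z \<in> S" using z by (auto simp: S_def span_base inner_commute)
    ultimately obtain v l where v: "v \<in> S" "norm v = 1" "f v = l *\<^sub>R v"
      using selfadjoint_eigenvector_in_subspace[OF f] z(1) by metis
    have "v \<notin> B" using v by (auto simp: S_def)
    have "P (insert v B)"
      using B v by (auto simp: P_def S_def pairwise_insert orthogonal_def inner_commute)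
    from max[OF this] show False using \<open>v \<notin> B\<close> fin by simp
  qed
  moreover obtain l where "\<forall>b\<in>B. f b = l b *\<^sub>R b"
    using B unfolding P_def by metis
  ultimately show ?thesis using B fin by (intro that[of B l]) (simp add: eigenbasis_def P_def)
qed

context
  fixes f :: "'a::euclidean_space \<Rightarrow> 'a" and B :: "'a set" and l :: "'a \<Rightarrow> real"
  assumes lin: "linear f" and eb: "eigenbasis f B l"
begin

lemma eigenbasis_expand: "x = (\<Sum>b\<in>B. (x \<bullet> b) *\<^sub>R b)"
  using orthonormal_basis_expand[of B x] eb by (simp add: eigenbasis_def)

lemma eigenbasis_inner: "x \<bullet> y = (\<Sum>b\<in>B. (x \<bullet> b) * (y \<bullet> b))"
proof -
  have "x \<bullet> y = x \<bullet> (\<Sum>b\<in>B. (y \<bullet> b) *\<^sub>R b)" using eigenbasis_expand[of y] by simp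
  then show ?thesis by (simp add: inner_sum_right mult.commute)
qed

lemma eigenbasis_funpow_basis: "b \<in> B \<Longrightarrow> (f ^^ k) b = (l b) ^ k *\<^sub>R b"
proof (induction k)
  case (Suc k)
  then show ?case using eb by (simp add: eigenbasis_def linear_cmul[OF lin] mult.commute)
qed simp

lemma linear_funpow: "linear (f ^^ k)"
proof (induction k)
  case (Suc k)
  then show ?case using linear_compose[OF Suc.IH lin] by (simp only: funpow.simps)
qed (simp add: linear_id[unfolded id_def])

lemma eigenbasis_funpow_quadratic: "v \<bullet> (f ^^ k) v = (\<Sum>b\<in>B. (l b) ^ k * (v \<bullet> b)\<^sup>2)"
proof -
  have "(f ^^ k) v = (f ^^ k) (\<Sum>b\<in>B. (v \<bullet> b) *\<^sub>R b)" using eigenbasis_expand[of v] by simp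
  also have "\<dots> = (\<Sum>b\<in>B. (v \<bullet> b) *\<^sub>R (l b) ^ k *\<^sub>R b)"
    by (simp add: linear_sum[OF linear_funpow] linear_cmul[OF linear_funpow] eigenbasis_funpow_basis)
  finally show ?thesis
    by (simp add: inner_sum_right power2_eq_square algebra_simps)
qed

lemma eigenbasis_quadratic: "v \<bullet> f v = (\<Sum>b\<in>B. l b * (v \<bullet> b)\<^sup>2)"
  using eigenbasis_funpow_quadratic[of v 1] by simp

end

section \<open>The trace of the exponential\<close>

text \<open>The quadratic form and the trace of \<open>e^f\<close> as scalar power series: being limits of polynomials
  in \<open>f\<close>, they depend measurably on \<open>f\<close>, and an eigenbasis evaluates them.\<close>

definition quad_exp :: "('a::euclidean_space \<Rightarrow> 'a) \<Rightarrow> 'a \<Rightarrow> real" where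
  "quad_exp f v = (\<Sum>k. (v \<bullet> (f ^^ k) v) / fact k)"

definition trace_exp :: "('a::euclidean_space \<Rightarrow> 'a) \<Rightarrow> real" where
  "trace_exp f = (\<Sum>e\<in>Basis. quad_exp f e)"

context
  fixes f :: "'a::euclidean_space \<Rightarrow> 'a" and B :: "'a set" and l :: "'a \<Rightarrow> real"
  assumes lin: "linear f" and eb: "eigenbasis f B l"
begin

lemma quad_exp_sums:
  "(\<lambda>k. (v \<bullet> (f ^^ k) v) / fact k) sums (\<Sum>b\<in>B. exp (l b) * (v \<bullet> b)\<^sup>2)"
proof -
  have "(\<lambda>k. \<Sum>b\<in>B. (l b ^ k /\<^sub>R fact k) * (v \<bullet> b)\<^sup>2) sums (\<Sum>b\<in>B. exp (l b) * (v \<bullet> b)\<^sup>2)"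
    by (intro sums_sum sums_mult2 exp_converges)
  moreover have "(v \<bullet> (f ^^ k) v) / fact k = (\<Sum>b\<in>B. (l b ^ k /\<^sub>R fact k) * (v \<bullet> b)\<^sup>2)" for k
    unfolding eigenbasis_funpow_quadratic[OF lin eb] sum_divide_distrib
    by (intro sum.cong refl) (simp add: field_simps)
  ultimately show ?thesis by simp
qed

lemma quad_exp_eigenbasis: "quad_exp f v = (\<Sum>b\<in>B. exp (l b) * (v \<bullet> b)\<^sup>2)"
  using quad_exp_sums by (simp add: quad_exp_def sums_iff)

lemma trace_exp_eigenbasis: "trace_exp f = (\<Sum>b\<in>B. exp (l b))"
proof -
  have "trace_exp f = (\<Sum>b\<in>B. exp (l b) * (\<Sum>e\<in>Basis. (e \<bullet> b)\<^sup>2))"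
    by (simp add: trace_exp_def quad_exp_eigenbasis sum_distrib_left sum.swap[of _ _ Basis])
  also have "\<dots> = (\<Sum>b\<in>B. exp (l b))"
  proof (intro sum.cong refl)
    fix b assume "b \<in> B"
    then have "b \<bullet> b = 1" using eb by (simp add: eigenbasis_def dot_square_norm)
    then have "(\<Sum>e\<in>Basis. (e \<bullet> b)\<^sup>2) = 1"
      using euclidean_inner[of b b] by (simp add: power2_eq_square inner_commute)
    then show "exp (l b) * (\<Sum>e\<in>Basis. (e \<bullet> b)\<^sup>2) = exp (l b)" by simp
  qed
  finally show ?thesis .
qed

lemma eigenbasis_shift: "eigenbasis (\<lambda>x. f x + c *\<^sub>R x) B (\<lambda>b. l b + c)"
  using eb by (simp add: eigenbasis_def scaleR_add_left)

end

lemma linear_shift: "linear f \<Longrightarrow> linear (\<lambda>x. f x + c *\<^sub>R x)"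
  by (intro linear_compose_add linear_compose_scale_right linear_id[unfolded id_def])

lemma selfadjoint_shift: "selfadjoint f \<Longrightarrow> selfadjoint (\<lambda>x. f x + c *\<^sub>R x)"
  by (auto simp: selfadjoint_def linear_shift inner_add)

lemma quad_exp_shift:
  assumes "selfadjoint f" shows "quad_exp (\<lambda>x. f x + c *\<^sub>R x) v = exp c * quad_exp f v"
proof -
  obtain B l where eb: "eigenbasis f B l" using selfadjoint_has_eigenbasis[OF assms] .
  note lin = selfadjoint_linear[OF assms]
  show ?thesis
    by (simp add: quad_exp_eigenbasis[OF lin eb]
        quad_exp_eigenbasis[OF linear_shift[OF lin] eigenbasis_shift[OF lin eb]]
        sum_distrib_left exp_add mult_ac)
qed

lemma trace_exp_shift:
  "selfadjoint f \<Longrightarrow> trace_exp (\<lambda>x. f x + c *\<^sub>R x) = exp c * trace_exp f"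
  by (simp add: trace_exp_def quad_exp_shift sum_distrib_left)

section \<open>Rank-one perturbations\<close>

definition rank_one_update :: "('a::real_inner \<Rightarrow> 'a) \<Rightarrow> 'a \<Rightarrow> real \<Rightarrow> 'a \<Rightarrow> 'a" where
  "rank_one_update f v t x = f x + (t * (v \<bullet> x)) *\<^sub>R v"

lemma selfadjoint_rank_one_update:
  assumes "selfadjoint f" shows "selfadjoint (rank_one_update f v t)"
proof -
  have "linear (\<lambda>x. (t * (v \<bullet> x)) *\<^sub>R v)"
    by (rule linearI) (auto simp: inner_add algebra_simps)
  then have "linear (rank_one_update f v t)"
    using linear_compose_add[OF selfadjoint_linear[OF assms]]
    by (simp add: rank_one_update_def[abs_def])
  then show ?thesis
    using selfadjoint_swap[OF assms]
    by (simp add: selfadjoint_def rank_one_update_def inner_add_left inner_add_right inner_commute[of v])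
qed

lemma rank_one_update_funpow_derivative:
  fixes f :: "'a::euclidean_space \<Rightarrow> 'a"
  assumes "selfadjoint f"
  shows "((\<lambda>t. (rank_one_update f v t ^^ k) x) has_vector_derivative
     (\<Sum>i<k. (v \<bullet> (rank_one_update f v t ^^ (k - 1 - i)) x) *\<^sub>R (rank_one_update f v t ^^ i) v)) (at t)"
proof (induction k)
  case (Suc k)
  let ?A = "rank_one_update f v"
  have lin: "linear (?A t)" by (intro selfadjoint_linear selfadjoint_rank_one_update assms)
  have bl: "bounded_linear f"
    using selfadjoint_linear[OF assms] by (simp add: linear_conv_bounded_linear)
  let ?D = "\<Sum>i<k. (v \<bullet> (?A t ^^ (k - 1 - i)) x) *\<^sub>R (?A t ^^ i) v"
  have "((\<lambda>t. f ((?A t ^^ k) x) + (t * (v \<bullet> (?A t ^^ k) x)) *\<^sub>R v) has_vector_derivative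
     f ?D + (t * (v \<bullet> ?D) + 1 * (v \<bullet> (?A t ^^ k) x)) *\<^sub>R v) (at t)"
  proof -
    have "((\<lambda>t. v \<bullet> (?A t ^^ k) x) has_vector_derivative (v \<bullet> ?D)) (at t)"
      by (rule bounded_linear.has_vector_derivative[OF bounded_linear_inner_right Suc.IH])
    then have 1: "((\<lambda>t. v \<bullet> (?A t ^^ k) x) has_real_derivative (v \<bullet> ?D)) (at t)"
      by (simp add: has_real_derivative_iff_has_vector_derivative)
    have "((\<lambda>t. t * (v \<bullet> (?A t ^^ k) x)) has_real_derivative
        (t * (v \<bullet> ?D) + 1 * (v \<bullet> (?A t ^^ k) x))) (at t)"
      using DERIV_mult[OF DERIV_ident 1] by (simp add: add.commute mult.commute)
    then have 2: "((\<lambda>t. (t * (v \<bullet> (?A t ^^ k) x)) *\<^sub>R v) has_vector_derivative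
        (t * (v \<bullet> ?D) + 1 * (v \<bullet> (?A t ^^ k) x)) *\<^sub>R v) (at t)"
      by (intro bounded_linear.has_vector_derivative[OF bounded_linear_scaleR_left])
         (simp add: has_real_derivative_iff_has_vector_derivative)
    have 3: "((\<lambda>t. f ((?A t ^^ k) x)) has_vector_derivative f ?D) (at t)"
      by (rule bounded_linear.has_vector_derivative[OF bl Suc.IH])
    show ?thesis by (rule has_vector_derivative_add[OF 3 2])
  qed
  moreover have "f ?D + (t * (v \<bullet> ?D) + 1 * (v \<bullet> (?A t ^^ k) x)) *\<^sub>R v
     = (\<Sum>i<Suc k. (v \<bullet> (?A t ^^ (Suc k - 1 - i)) x) *\<^sub>R (?A t ^^ i) v)"
  proof -
    have "f ?D + (t * (v \<bullet> ?D) + 1 * (v \<bullet> (?A t ^^ k) x)) *\<^sub>R v = ?A t ?D + (v \<bullet> (?A t ^^ k) x) *\<^sub>R v"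
      by (simp add: rank_one_update_def algebra_simps)
    also have "?A t ?D = (\<Sum>i<k. (v \<bullet> (?A t ^^ (k - 1 - i)) x) *\<^sub>R (?A t ^^ Suc i) v)"
      by (simp add: linear_sum[OF lin] linear_cmul[OF lin])
    finally show ?thesis
      by (simp add: sum.lessThan_Suc_shift del: sum.lessThan_Suc)
  qed
  ultimately show ?case
    by (simp add: rank_one_update_def[abs_def])
qed simp

lemma rank_one_quadratic_derivative:
  fixes f :: "'a::euclidean_space \<Rightarrow> 'a" and v :: 'a
  assumes f: "selfadjoint f"
  defines "q \<equiv> \<lambda>k t. v \<bullet> (rank_one_update f v t ^^ k) v"
  shows "(q k has_real_derivative (\<Sum>i<k. q (k - 1 - i) t * q i t)) (at t)"
proof -
  have "(q k has_vector_derivative v \<bullet> (\<Sum>i<k. (v \<bullet> (rank_one_update f v t ^^ (k - 1 - i)) v) *\<^sub>R (rank_one_update f v t ^^ i) v)) (at t)"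
    unfolding q_def
    by (rule bounded_linear.has_vector_derivative[OF bounded_linear_inner_right
          rank_one_update_funpow_derivative[OF f]])
  then show ?thesis
    by (simp add: q_def inner_sum_right has_real_derivative_iff_has_vector_derivative)
qed

text \<open>By cyclicity of the trace, each of the \<open>k\<close> terms of the derivative of the \<open>k\<close>-th power
  contributes the same quadratic form.\<close>

lemma rank_one_trace_derivative:
  fixes f :: "'a::euclidean_space \<Rightarrow> 'a"
  assumes f: "selfadjoint f"
  shows "((\<lambda>t. \<Sum>e\<in>Basis. e \<bullet> (rank_one_update f v t ^^ k) e) has_real_derivative
     real k * (v \<bullet> (rank_one_update f v t ^^ (k - 1)) v)) (at t)"
proof -
  let ?A = "rank_one_update f v t"
  have sa: "selfadjoint ?A" by (rule selfadjoint_rank_one_update[OF f])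
  have "((\<lambda>t. \<Sum>e\<in>Basis. e \<bullet> (rank_one_update f v t ^^ k) e) has_vector_derivative
     (\<Sum>e\<in>Basis. e \<bullet> (\<Sum>i<k. (v \<bullet> (?A ^^ (k - 1 - i)) e) *\<^sub>R (?A ^^ i) v))) (at t)"
    by (intro has_vector_derivative_sum bounded_linear.has_vector_derivative[OF bounded_linear_inner_right]
        rank_one_update_funpow_derivative[OF f])
  moreover have "(\<Sum>e\<in>Basis. e \<bullet> (\<Sum>i<k. (v \<bullet> (?A ^^ (k - 1 - i)) e) *\<^sub>R (?A ^^ i) v))
      = (\<Sum>i<k. \<Sum>e\<in>Basis. ((?A ^^ (k - 1 - i)) v \<bullet> e) * ((?A ^^ i) v \<bullet> e))"
  proof -
    have "(\<Sum>e\<in>Basis. e \<bullet> (\<Sum>i<k. (v \<bullet> (?A ^^ (k - 1 - i)) e) *\<^sub>R (?A ^^ i) v))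
      = (\<Sum>e\<in>Basis. \<Sum>i<k. ((?A ^^ (k - 1 - i)) v \<bullet> e) * ((?A ^^ i) v \<bullet> e))"
      unfolding inner_sum_right inner_scaleR_right selfadjoint_funpow_swap[OF sa, of "k - 1 - _" v]
      by (intro sum.cong refl) (simp add: inner_commute)
    then show ?thesis by (simp only: sum.swap[of _ Basis])
  qed
  moreover have "\<dots> = (\<Sum>i<k. v \<bullet> (?A ^^ (k - 1)) v)"
  proof (intro sum.cong refl)
    fix i assume "i \<in> {..<k}"
    then have "k - 1 = (k - 1 - i) + i" by simp
    then have "(?A ^^ (k - 1)) v = (?A ^^ (k - 1 - i)) ((?A ^^ i) v)"
      by (metis funpow_add o_apply)
    then show "(\<Sum>e\<in>Basis. ((?A ^^ (k - 1 - i)) v \<bullet> e) * ((?A ^^ i) v \<bullet> e)) = v \<bullet> (?A ^^ (k - 1)) v"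
      using euclidean_inner[of "(?A ^^ (k - 1 - i)) v" "(?A ^^ i) v"]
      by (simp only: selfadjoint_funpow_swap[OF sa])
  qed
  ultimately show ?thesis
    by (simp add: has_real_derivative_iff_has_vector_derivative)
qed

text \<open>Chebyshev's inequality for the spectral measure of the unit vector \<open>v\<close>, which puts mass
  \<open>(v \<bullet> b)\<^sup>2\<close> on \<open>l b\<close>: powers of the same nonnegative variable are positively correlated.\<close>

lemma eigenbasis_moments_supermultiplicative:
  assumes lin: "linear f" and eb: "eigenbasis f B l"
    and nonneg: "\<And>b. b \<in> B \<Longrightarrow> 0 \<le> l b" and v: "norm v = 1"
  shows "(v \<bullet> (f ^^ i) v) * (v \<bullet> (f ^^ j) v) \<le> v \<bullet> (f ^^ (i + j)) v"
proof -
  define w where "w b = (v \<bullet> b)\<^sup>2" for b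
  have w1: "(\<Sum>b\<in>B. w b) = 1"
    using eigenbasis_inner[OF lin eb, of v v] v
    by (simp add: w_def power2_eq_square dot_square_norm)
  have mono: "0 \<le> (x ^ i - y ^ i) * (x ^ j - y ^ j)" if "0 \<le> x" "0 \<le> y" for x y :: real
    using that power_mono[of x y i] power_mono[of x y j] power_mono[of y x i] power_mono[of y x j]
    by (cases "x \<le> y") (auto intro: mult_nonpos_nonpos mult_nonneg_nonneg)
  have "0 \<le> (\<Sum>b\<in>B. \<Sum>c\<in>B. w b * w c * ((l b ^ i - l c ^ i) * (l b ^ j - l c ^ j)))"
    by (intro sum_nonneg mult_nonneg_nonneg[OF _ mono]) (auto simp: w_def nonneg)
  also have "\<dots> = (\<Sum>b\<in>B. \<Sum>c\<in>B. w b * l b ^ (i + j) * w c) + (\<Sum>b\<in>B. \<Sum>c\<in>B. w b * (w c * l c ^ (i + j)))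
      - (\<Sum>b\<in>B. \<Sum>c\<in>B. (w b * l b ^ i) * (w c * l c ^ j)) - (\<Sum>b\<in>B. \<Sum>c\<in>B. (w b * l b ^ j) * (w c * l c ^ i))"
    by (simp add: sum.distrib[symmetric] sum_subtractf[symmetric] power_add algebra_simps)
  also have "\<dots> = 2 * ((\<Sum>b\<in>B. w b * l b ^ (i + j)) - (\<Sum>b\<in>B. w b * l b ^ i) * (\<Sum>b\<in>B. w b * l b ^ j))"
    by (simp add: sum_product[symmetric] w1 sum_distrib_left[symmetric] sum_distrib_right[symmetric])
  finally show ?thesis
    by (simp add: eigenbasis_funpow_quadratic[OF lin eb] w_def mult.commute)
qed

text \<open>Truncating the exponential series at degree \<open>N\<close> leaves polynomials in \<open>t\<close>. With \<open>F\<close> the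
  truncated trace and \<open>G\<close> the truncated quadratic form at \<open>v\<close>, one has \<open>F' = G\<close> and \<open>G' \<le> G\<close>. Thus
  \<open>e^(-s) G s\<close> decreases, and \<open>F s - e^s G 0\<close> is largest at \<open>s = 0\<close>, whatever the sign of \<open>t\<close>.\<close>

lemma rank_one_truncated_trace_exp:
  fixes f :: "'a::euclidean_space \<Rightarrow> 'a" and v :: 'a and t :: real
  assumes f: "selfadjoint f" and v: "norm v = 1"
    and psd: "\<And>s x. s \<in> closed_segment 0 t \<Longrightarrow> 0 \<le> x \<bullet> rank_one_update f v s x"
  defines "q \<equiv> \<lambda>k s. v \<bullet> (rank_one_update f v s ^^ k) v"
    and "p \<equiv> \<lambda>k s. \<Sum>e\<in>Basis. e \<bullet> (rank_one_update f v s ^^ k) e"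
  shows "(\<Sum>k\<le>N. p k t / fact k) \<le> (\<Sum>k\<le>N. p k 0 / fact k) + (exp t - 1) * (\<Sum>k<N. q k 0 / fact k)"
proof -
  define F where "F s = (\<Sum>k\<le>N. p k s / fact k)" for s
  define G where "G s = (\<Sum>k<N. q k s / fact k)" for s
  have shift: "(\<Sum>k<Suc n. real k * a (k - 1) / fact k) = (\<Sum>k<n. a k / fact k)" for a n
    by (simp add: sum.lessThan_Suc_shift del: sum.lessThan_Suc)
  have F': "(F has_real_derivative G s) (at s)" for s
  proof -
    have "(F has_real_derivative (\<Sum>k\<le>N. real k * q (k - 1) s / fact k)) (at s)"
      unfolding F_def p_def q_def
      by (intro DERIV_sum DERIV_cdivide rank_one_trace_derivative f)
    then show ?thesis using shift[of "\<lambda>k. q k s" N] by (simp add: G_def lessThan_Suc_atMost)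
  qed
  have G': "(G has_real_derivative (\<Sum>k<N. (\<Sum>i<k. q (k - 1 - i) s * q i s) / fact k)) (at s)" for s
    unfolding G_def q_def by (intro DERIV_sum DERIV_cdivide rank_one_quadratic_derivative f)
  have G'_le: "(\<Sum>k<N. (\<Sum>i<k. q (k - 1 - i) s * q i s) / fact k) \<le> G s"
    if s: "s \<in> closed_segment 0 t" for s
  proof -
    let ?A = "rank_one_update f v s"
    have sa: "selfadjoint ?A" by (rule selfadjoint_rank_one_update[OF f])
    obtain B l where eb: "eigenbasis ?A B l" using selfadjoint_has_eigenbasis[OF sa] .
    note lin = selfadjoint_linear[OF sa]
    have l: "0 \<le> l b" if "b \<in> B" for b
      using psd[OF s, of b] eb that by (simp add: eigenbasis_def dot_square_norm)
    have q0: "0 \<le> q k s" for k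
      unfolding q_def eigenbasis_funpow_quadratic[OF lin eb] by (intro sum_nonneg) (simp add: l)
    have "(\<Sum>i<k. q (k - 1 - i) s * q i s) \<le> real k * q (k - 1) s" for k
    proof -
      have "(\<Sum>i<k. q (k - 1 - i) s * q i s) \<le> (\<Sum>i<k. q (k - 1) s)"
      proof (intro sum_mono)
        fix i assume "i \<in> {..<k}"
        then show "q (k - 1 - i) s * q i s \<le> q (k - 1) s"
          using eigenbasis_moments_supermultiplicative[OF lin eb l v, of "k - 1 - i" i] by (simp add: q_def)
      qed
      then show ?thesis by simp
    qed
    then have "(\<Sum>k<N. (\<Sum>i<k. q (k - 1 - i) s * q i s) / fact k) \<le> (\<Sum>k<N. real k * q (k - 1) s / fact k)"
      by (intro sum_mono divide_right_mono) auto
    also have "\<dots> \<le> (\<Sum>k<Suc N. real k * q (k - 1) s / fact k)"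
      by (simp add: q0)
    also have "\<dots> = G s" using shift[of "\<lambda>k. q k s" N] by (simp add: G_def)
    finally show ?thesis .
  qed
  define E where "E s = exp (- s) * G s" for s
  define H where "H s = F s - exp s * G 0" for s
  have E': "\<exists>y. (E has_real_derivative y) (at s) \<and> y \<le> 0" if s: "s \<in> closed_segment 0 t" for s
  proof -
    let ?D = "\<Sum>k<N. (\<Sum>i<k. q (k - 1 - i) s * q i s) / fact k"
    have "(E has_real_derivative (exp (- s) * (- 1) * G s + ?D * exp (- s))) (at s)"
      unfolding E_def by (rule DERIV_mult DERIV_fun_exp DERIV_minus DERIV_ident G')+
    moreover have "exp (- s) * (- 1) * G s + ?D * exp (- s) \<le> 0"
      using mult_left_mono[OF G'_le[OF s], of "exp (- s)"] by (simp add: mult.commute)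
    ultimately show ?thesis by blast
  qed
  have GE: "G s = exp s * E s" for s by (simp add: E_def exp_minus)
  have E0: "E 0 = G 0" by (simp add: E_def)
  have H': "(H has_real_derivative (G s - exp s * G 0)) (at s)" for s
    unfolding H_def by (rule DERIV_diff[OF F' DERIV_cmult_right[OF DERIV_exp]])
  have "H t \<le> H 0"
  proof (cases "0 \<le> t")
    case True
    have "G s - exp s * G 0 \<le> 0" if "0 \<le> s" "s \<le> t" for s
    proof -
      have "E s \<le> E 0"
        using that True by (intro DERIV_nonpos_imp_nonincreasing[of 0 s E] E')
          (auto simp: closed_segment_eq_real_ivl)
      then show ?thesis by (simp add: GE[of s] E0)
    qed
    then show ?thesis using H' by (intro DERIV_nonpos_imp_nonincreasing[OF True]) blast
  next
    case False
    have "0 \<le> G s - exp s * G 0" if "t \<le> s" "s \<le> 0" for s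
    proof -
      have "E 0 \<le> E s"
        using that False by (intro DERIV_nonpos_imp_nonincreasing[of s 0 E] E')
          (auto simp: closed_segment_eq_real_ivl)
      then show ?thesis by (simp add: GE[of s] E0)
    qed
    then show ?thesis using H' False by (intro DERIV_nonneg_imp_nondecreasing[of t 0 H]) (simp, blast)
  qed
  then show ?thesis by (simp add: H_def F_def G_def algebra_simps)
qed

lemma trace_exp_rank_one_update_psd:
  fixes f :: "'a::euclidean_space \<Rightarrow> 'a"
  assumes f: "selfadjoint f" and v: "norm v = 1"
    and psd: "\<And>s x. s \<in> closed_segment 0 t \<Longrightarrow> 0 \<le> x \<bullet> rank_one_update f v s x"
  shows "trace_exp (rank_one_update f v t) \<le> trace_exp f + (exp t - 1) * quad_exp f v"
proof -
  have f0: "rank_one_update f v 0 = f" by (simp add: rank_one_update_def fun_eq_iff)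
  have trace: "(\<lambda>N. \<Sum>k\<le>N. (\<Sum>e\<in>Basis. e \<bullet> (g ^^ k) e) / fact k) \<longlonglongrightarrow> trace_exp g"
    and quad: "(\<lambda>N. \<Sum>k<N. (x \<bullet> (g ^^ k) x) / fact k) \<longlonglongrightarrow> quad_exp g x"
    if g: "selfadjoint g" for g :: "'a \<Rightarrow> 'a" and x
  proof -
    obtain B l where eb: "eigenbasis g B l" using selfadjoint_has_eigenbasis[OF g] .
    note s = quad_exp_sums[OF selfadjoint_linear[OF g] eb, folded quad_exp_eigenbasis[OF selfadjoint_linear[OF g] eb]]
    show "(\<lambda>N. \<Sum>k<N. (x \<bullet> (g ^^ k) x) / fact k) \<longlonglongrightarrow> quad_exp g x"
      using s by (simp add: sums_def)
    have "(\<lambda>k. \<Sum>e\<in>Basis. (e \<bullet> (g ^^ k) e) / fact k) sums (\<Sum>e\<in>Basis. quad_exp g e)"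
      by (intro sums_sum s)
    then show "(\<lambda>N. \<Sum>k\<le>N. (\<Sum>e\<in>Basis. e \<bullet> (g ^^ k) e) / fact k) \<longlonglongrightarrow> trace_exp g"
      by (simp add: trace_exp_def sums_def_le sum_divide_distrib)
  qed
  show ?thesis
    using rank_one_truncated_trace_exp[OF f v psd]
    by (intro LIMSEQ_le[OF trace[OF selfadjoint_rank_one_update[OF f]]
          tendsto_add[OF trace[OF f] tendsto_mult_left[OF quad[OF f]]]])
      (auto simp: f0)
qed

lemma eigenbasis_quadratic_lower_bound:
  fixes f :: "'a::euclidean_space \<Rightarrow> 'a"
  assumes "linear f" and eb: "eigenbasis f B l"
  shows "- (\<Sum>b\<in>B. \<bar>l b\<bar>) * (norm x)\<^sup>2 \<le> x \<bullet> f x"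
proof -
  have "finite B" using eb by (simp add: eigenbasis_def)
  have "(x \<bullet> b)\<^sup>2 \<le> (norm x)\<^sup>2" if "b \<in> B" for b
    using Cauchy_Schwarz_ineq2[of x b] eb that by (simp add: eigenbasis_def abs_le_square_iff[symmetric])
  then have "(\<Sum>b\<in>B. - \<bar>l b\<bar> * (norm x)\<^sup>2) \<le> (\<Sum>b\<in>B. l b * (x \<bullet> b)\<^sup>2)"
  proof (intro sum_mono)
    fix b assume "b \<in> B"
    have "- (l b * (x \<bullet> b)\<^sup>2) \<le> \<bar>l b\<bar> * (x \<bullet> b)\<^sup>2"
      by (metis abs_ge_minus_self abs_mult abs_power2)
    also have "\<dots> \<le> \<bar>l b\<bar> * (norm x)\<^sup>2"
      using \<open>b \<in> B\<close> \<open>\<And>b. b \<in> B \<Longrightarrow> (x \<bullet> b)\<^sup>2 \<le> (norm x)\<^sup>2\<close> by (intro mult_left_mono) auto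
    finally show "- \<bar>l b\<bar> * (norm x)\<^sup>2 \<le> l b * (x \<bullet> b)\<^sup>2" by simp
  qed
  then show ?thesis
    by (simp add: eigenbasis_quadratic[OF assms] sum_distrib_right sum_negf)
qed

text \<open>The rank-one case of the Golden-Thompson inequality. The value \<open>v = 0\<close> is admitted because the
  feature vector of a point may vanish.\<close>

lemma trace_exp_rank_one_update:
  fixes f :: "'a::euclidean_space \<Rightarrow> 'a"
  assumes f: "selfadjoint f" and v: "norm v = 1 \<or> v = 0"
  shows "trace_exp (rank_one_update f v t) \<le> trace_exp f + (exp t - 1) * quad_exp f v"
proof (cases "v = 0")
  case True
  then have "rank_one_update f v t = f" by (simp add: rank_one_update_def fun_eq_iff)
  with True show ?thesis by (simp add: quad_exp_def)
next
  case False
  with v have v1: "norm v = 1" by simp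
  obtain B l where eb: "eigenbasis f B l" using selfadjoint_has_eigenbasis[OF f] .
  \<comment> \<open>Both sides scale by \<open>exp c\<close> under this shift, which makes the whole segment of updates positive.\<close>
  define c where "c = (\<Sum>b\<in>B. \<bar>l b\<bar>) + \<bar>t\<bar>"
  define g where "g x = f x + c *\<^sub>R x" for x
  have g: "selfadjoint g" unfolding g_def[abs_def] by (rule selfadjoint_shift[OF f])
  have upd: "rank_one_update g v s = (\<lambda>x. rank_one_update f v s x + c *\<^sub>R x)" for s
    by (simp add: rank_one_update_def g_def fun_eq_iff)
  have "0 \<le> x \<bullet> rank_one_update g v s x" if "s \<in> closed_segment 0 t" for s x
  proof -
    have s: "\<bar>s\<bar> \<le> \<bar>t\<bar>" using that by (auto simp: closed_segment_eq_real_ivl split: if_splits)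
    have vx: "(v \<bullet> x)\<^sup>2 \<le> (norm x)\<^sup>2"
      using Cauchy_Schwarz_ineq2[of v x] v1 by (simp add: abs_le_square_iff[symmetric])
    have "- (s * (v \<bullet> x)\<^sup>2) \<le> \<bar>s\<bar> * (v \<bullet> x)\<^sup>2"
      by (metis abs_ge_minus_self abs_mult abs_power2)
    also have "\<dots> \<le> \<bar>t\<bar> * (norm x)\<^sup>2" using s vx by (intro mult_mono) auto
    finally have "- (s * (v \<bullet> x)\<^sup>2) \<le> \<bar>t\<bar> * (norm x)\<^sup>2" .
    moreover have "x \<bullet> rank_one_update g v s x = x \<bullet> f x + c * (norm x)\<^sup>2 + s * (v \<bullet> x)\<^sup>2"
      by (simp add: rank_one_update_def g_def inner_add_right dot_square_norm power2_eq_square inner_commute)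
    ultimately show ?thesis
      using eigenbasis_quadratic_lower_bound[OF selfadjoint_linear[OF f] eb, of x]
      by (simp add: c_def algebra_simps)
  qed
  note psd = this
  have trace_g: "trace_exp g = exp c * trace_exp f" and quad_g: "quad_exp g v = exp c * quad_exp f v"
    unfolding g_def[abs_def] by (rule trace_exp_shift[OF f] quad_exp_shift[OF f])+
  have trace_upd: "trace_exp (rank_one_update g v t) = exp c * trace_exp (rank_one_update f v t)"
    unfolding upd by (rule trace_exp_shift[OF selfadjoint_rank_one_update[OF f]])
  from trace_exp_rank_one_update_psd[OF g v1 psd, of t]
  have "exp c * trace_exp (rank_one_update f v t) \<le> exp c * (trace_exp f + (exp t - 1) * quad_exp f v)"
    unfolding trace_g trace_upd quad_g by (simp add: algebra_simps)
  then show ?thesis by simp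
qed

section \<open>Random sums of rank-one projections\<close>

definition rank_one_sum :: "real \<Rightarrow> 'i set \<Rightarrow> ('i \<Rightarrow> 'a::real_inner) \<Rightarrow> 'a \<Rightarrow> 'a" where
  "rank_one_sum t I w x = (\<Sum>i\<in>I. (t * (w i \<bullet> x)) *\<^sub>R w i)"

lemma rank_one_sum_empty: "rank_one_sum t {} w = (\<lambda>_. 0)"
  by (simp add: rank_one_sum_def fun_eq_iff)

lemma rank_one_sum_insert:
  "finite I \<Longrightarrow> i \<notin> I \<Longrightarrow>
    rank_one_sum t (insert i I) w = rank_one_update (rank_one_sum t I w) (w i) t"
  by (simp add: rank_one_sum_def rank_one_update_def fun_eq_iff add.commute)

lemma rank_one_sum_cong:
  "(\<And>i. i \<in> I \<Longrightarrow> w i = w' i) \<Longrightarrow> rank_one_sum t I w = rank_one_sum t I w'"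
  by (simp add: rank_one_sum_def fun_eq_iff)

lemma selfadjoint_zero: "selfadjoint (\<lambda>_. 0)"
  by (simp add: selfadjoint_def linear_zero)

lemma selfadjoint_rank_one_sum: "finite I \<Longrightarrow> selfadjoint (rank_one_sum t I w)"
proof (induction I rule: finite_induct)
  case empty
  then show ?case by (simp add: rank_one_sum_empty selfadjoint_zero)
next
  case (insert i I)
  then show ?case by (simp add: rank_one_sum_insert selfadjoint_rank_one_update)
qed

lemma trace_exp_zero: "trace_exp (\<lambda>_::'a::euclidean_space. 0::'a) = real DIM('a)"
proof -
  let ?z = "\<lambda>_::'a. 0::'a"
  obtain B l where eb: "eigenbasis ?z B l" using selfadjoint_has_eigenbasis[OF selfadjoint_zero] .
  note lin = selfadjoint_linear[OF selfadjoint_zero]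
  have l: "l b = 0" if "b \<in> B" for b using eb that by (force simp: eigenbasis_def)
  have "quad_exp ?z e = e \<bullet> e" for e
    unfolding quad_exp_eigenbasis[OF lin eb] eigenbasis_inner[OF lin eb, of e e]
    by (intro sum.cong refl) (simp add: l power2_eq_square)
  then show ?thesis by (simp add: trace_exp_def)
qed

lemma trace_exp_ge_eigenvalue:
  assumes "linear f" "eigenbasis f B l" "b \<in> B"
  shows "exp (l b) \<le> trace_exp f"
  unfolding trace_exp_eigenbasis[OF assms(1,2)]
  using assms by (intro member_le_sum) (auto simp: eigenbasis_def)

lemma trace_exp_nonneg: "selfadjoint f \<Longrightarrow> 0 \<le> trace_exp f"
  by (metis selfadjoint_has_eigenbasis selfadjoint_linear trace_exp_eigenbasis sum_nonneg exp_ge_zero)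

lemma trace_exp_rank_one_sum_measurable:
  fixes w :: "'x \<Rightarrow> 'i \<Rightarrow> 'a::euclidean_space"
  assumes [measurable]: "\<And>i. i \<in> I \<Longrightarrow> (\<lambda>x. w x i) \<in> borel_measurable M"
  shows "(\<lambda>x. trace_exp (rank_one_sum t I (w x))) \<in> borel_measurable M"
proof -
  have [measurable]: "(\<lambda>x. (rank_one_sum t I (w x) ^^ k) e) \<in> borel_measurable M" for k e
  proof (induction k)
    case (Suc k)
    note Suc[measurable]
    have "(\<lambda>x. rank_one_sum t I (w x) ((rank_one_sum t I (w x) ^^ k) e)) \<in> borel_measurable M"
      unfolding rank_one_sum_def[of t I _ "(_ ^^ _) _"] by measurable
    then show ?case by simp
  qed simp
  show ?thesis unfolding trace_exp_def quad_exp_def by measurable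
qed

text \<open>A random projection of rank at most one whose mean is \<open>I / DIM('a)\<close>; the mean is stated through
  its quadratic form.\<close>

locale isotropic_directions = prob_space \<rho> for \<rho> :: "'x measure" +
  fixes V :: "'x \<Rightarrow> 'a::euclidean_space"
  assumes V_measurable[measurable]: "V \<in> borel_measurable \<rho>"
    and V_norm: "norm (V x) = 1 \<or> V x = 0"
    and V_isotropic: "(LINT x|\<rho>. (V x \<bullet> e)\<^sup>2) = (norm e)\<^sup>2 / real DIM('a)"
begin

lemma V_inner_square_integrable: "integrable \<rho> (\<lambda>x. (V x \<bullet> e)\<^sup>2)"
proof (rule integrable_const_bound)
  have "\<bar>V x \<bullet> e\<bar> \<le> norm e" for x
    using Cauchy_Schwarz_ineq2[of "V x" e] V_norm[of x] by auto
  then show "AE x in \<rho>. norm ((V x \<bullet> e)\<^sup>2) \<le> (norm e)\<^sup>2"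
    by (simp add: abs_le_square_iff[symmetric])
qed simp

lemma quad_exp_V_integral:
  assumes f: "selfadjoint f"
  shows "integrable \<rho> (\<lambda>x. quad_exp f (V x))"
    and "(LINT x|\<rho>. quad_exp f (V x)) = trace_exp f / real DIM('a)"
proof -
  obtain B l where eb: "eigenbasis f B l" using selfadjoint_has_eigenbasis[OF f] .
  note lin = selfadjoint_linear[OF f]
  show "integrable \<rho> (\<lambda>x. quad_exp f (V x))"
    unfolding quad_exp_eigenbasis[OF lin eb]
    by (intro Bochner_Integration.integrable_sum integrable_mult_right V_inner_square_integrable)
  have "norm b = 1" if "b \<in> B" for b using eb that by (simp add: eigenbasis_def)
  then show "(LINT x|\<rho>. quad_exp f (V x)) = trace_exp f / real DIM('a)"
    unfolding quad_exp_eigenbasis[OF lin eb] trace_exp_eigenbasis[OF lin eb]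
    by (subst Bochner_Integration.integral_sum)
      (auto simp: V_inner_square_integrable V_isotropic sum_divide_distrib)
qed

text \<open>The mean of \<open>quad_exp f (V x)\<close> is \<open>trace_exp f / DIM('a)\<close> by isotropy, so averaging the
  rank-one inequality closes up to a recursion for the trace alone.\<close>

lemma trace_exp_update_expectation:
  assumes f: "selfadjoint f"
  shows "(\<integral>\<^sup>+x. ennreal (trace_exp (rank_one_update f (V x) t)) \<partial>\<rho>)
    \<le> ennreal (trace_exp f * (1 + (exp t - 1) / real DIM('a)))"
proof -
  note upd = trace_exp_rank_one_update[OF f V_norm]
  have nn: "0 \<le> trace_exp f + (exp t - 1) * quad_exp f (V x)" for x
    using upd[of x t] trace_exp_nonneg[OF selfadjoint_rank_one_update[OF f], of "V x" t] by linarith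
  have "(\<integral>\<^sup>+x. ennreal (trace_exp (rank_one_update f (V x) t)) \<partial>\<rho>)
      \<le> (\<integral>\<^sup>+x. ennreal (trace_exp f + (exp t - 1) * quad_exp f (V x)) \<partial>\<rho>)"
    by (intro nn_integral_mono ennreal_leI upd)
  also have "\<dots> = ennreal (LINT x|\<rho>. trace_exp f + (exp t - 1) * quad_exp f (V x))"
    using nn quad_exp_V_integral(1)[OF f] by (intro nn_integral_eq_integral) auto
  also have "(LINT x|\<rho>. trace_exp f + (exp t - 1) * quad_exp f (V x))
      = trace_exp f * (1 + (exp t - 1) / real DIM('a))"
    using quad_exp_V_integral[OF f] by (simp add: prob_space field_simps)
  finally show ?thesis .
qed

lemma V_component_measurable:
  assumes "i \<in> I" shows "(\<lambda>\<omega>. V (\<omega> i)) \<in> borel_measurable (PiM I (\<lambda>_. \<rho>))"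
proof -
  have "(\<lambda>\<omega>. \<omega> i) \<in> measurable (PiM I (\<lambda>_. \<rho>)) \<rho>" using assms by simp
  from measurable_compose[OF this V_measurable] show ?thesis .
qed

lemma expected_trace_exp_rank_one_sum:
  assumes "finite I"
  shows "(\<integral>\<^sup>+\<omega>. ennreal (trace_exp (rank_one_sum t I (\<lambda>i. V (\<omega> i)))) \<partial>PiM I (\<lambda>_. \<rho>))
    \<le> ennreal (real DIM('a) * (1 + (exp t - 1) / real DIM('a)) ^ card I)"
  using assms
proof (induction I rule: finite_induct)
  case empty
  interpret E: prob_space "PiM {} (\<lambda>_. \<rho>)" by (intro prob_space_PiM) simp
  show ?case by (simp add: rank_one_sum_empty trace_exp_zero E.emeasure_space_1)
next
  case (insert i I)
  interpret P: product_sigma_finite "\<lambda>_. \<rho>" ..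
  let ?d = "real DIM('a)" and ?w = "\<lambda>\<omega> i. V (\<omega> i)"
  have d: "1 \<le> ?d" using DIM_positive[where 'a='a] by linarith
  have "- ?d \<le> exp t - 1" using d exp_gt_zero[of t] by linarith
  then have factor: "0 \<le> 1 + (exp t - 1) / ?d" using d by (simp add: field_simps)
  have upd: "rank_one_sum t (insert i I) (?w (fun_upd \<omega> i y)) = rank_one_update (rank_one_sum t I (?w \<omega>)) (V y) t"
    for \<omega> y
  proof -
    have "rank_one_sum t I (?w (fun_upd \<omega> i y)) = rank_one_sum t I (?w \<omega>)"
      using insert.hyps by (intro rank_one_sum_cong) auto
    then show ?thesis using insert.hyps by (simp add: rank_one_sum_insert)
  qed
  have "(\<integral>\<^sup>+\<omega>. ennreal (trace_exp (rank_one_sum t (insert i I) (?w \<omega>))) \<partial>PiM (insert i I) (\<lambda>_. \<rho>))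
     = (\<integral>\<^sup>+\<omega>. (\<integral>\<^sup>+y. ennreal (trace_exp (rank_one_sum t (insert i I) (?w (fun_upd \<omega> i y)))) \<partial>\<rho>) \<partial>PiM I (\<lambda>_. \<rho>))"
    using insert.hyps
    by (intro P.product_nn_integral_insert measurable_compose[OF _ measurable_ennreal]
        trace_exp_rank_one_sum_measurable V_component_measurable) auto
  also have "\<dots> \<le> (\<integral>\<^sup>+\<omega>. ennreal (trace_exp (rank_one_sum t I (?w \<omega>)) * (1 + (exp t - 1) / ?d)) \<partial>PiM I (\<lambda>_. \<rho>))"
    unfolding upd using insert.hyps
    by (intro nn_integral_mono trace_exp_update_expectation selfadjoint_rank_one_sum)
  also have "\<dots> = (\<integral>\<^sup>+\<omega>. ennreal (trace_exp (rank_one_sum t I (?w \<omega>))) \<partial>PiM I (\<lambda>_. \<rho>)) * ennreal (1 + (exp t - 1) / ?d)"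
    using insert.hyps factor
    by (subst nn_integral_multc[symmetric])
      (auto intro!: nn_integral_cong measurable_compose[OF _ measurable_ennreal]
        trace_exp_rank_one_sum_measurable V_component_measurable
        simp: ennreal_mult trace_exp_nonneg selfadjoint_rank_one_sum)
  also have "\<dots> \<le> ennreal (?d * (1 + (exp t - 1) / ?d) ^ card I) * ennreal (1 + (exp t - 1) / ?d)"
    by (intro mult_right_mono insert.IH) simp
  also have "\<dots> = ennreal (?d * (1 + (exp t - 1) / ?d) ^ card (insert i I))"
    using factor insert.hyps by (simp add: ennreal_mult[symmetric] mult_ac)
  finally show ?case .
qed

text \<open>Markov's inequality, with \<open>1 + y \<le> e^y\<close> applied to each factor of the expectation bound.\<close>

lemma trace_exp_rank_one_sum_tail:
  assumes "finite I"
  shows "emeasure (PiM I (\<lambda>_. \<rho>)) {\<omega> \<in> space (PiM I (\<lambda>_. \<rho>)). exp a \<le> trace_exp (rank_one_sum t I (\<lambda>i. V (\<omega> i)))}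
    \<le> ennreal (real DIM('a) * exp (real (card I) * (exp t - 1) / real DIM('a) - a))"
proof -
  let ?M = "PiM I (\<lambda>_. \<rho>)" and ?d = "real DIM('a)" and ?T = "\<lambda>\<omega>. trace_exp (rank_one_sum t I (\<lambda>i. V (\<omega> i)))"
  have d: "1 \<le> ?d" using DIM_positive[where 'a='a] by linarith
  have "- ?d \<le> exp t - 1" using d exp_gt_zero[of t] by linarith
  then have factor: "0 \<le> 1 + (exp t - 1) / ?d" using d by (simp add: field_simps)
  have [measurable]: "?T \<in> borel_measurable ?M"
    by (intro trace_exp_rank_one_sum_measurable V_component_measurable)
  have "{\<omega> \<in> space ?M. exp a \<le> ?T \<omega>} = {\<omega> \<in> space ?M. 1 \<le> ennreal (exp (- a)) * ennreal (?T \<omega>)}"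
  proof -
    have "1 \<le> ennreal (exp (- a)) * ennreal (?T \<omega>) \<longleftrightarrow> exp a \<le> ?T \<omega>" for \<omega>
    proof -
      have "ennreal (exp (- a)) * ennreal (?T \<omega>) = ennreal (exp (- a) * ?T \<omega>)"
        by (rule ennreal_mult[symmetric]) (simp_all add: trace_exp_nonneg selfadjoint_rank_one_sum assms)
      then show ?thesis by (simp add: exp_minus field_simps)
    qed
    then show ?thesis by simp
  qed
  then have "emeasure ?M {\<omega> \<in> space ?M. exp a \<le> ?T \<omega>} \<le> ennreal (exp (- a)) * (\<integral>\<^sup>+\<omega>. ennreal (?T \<omega>) \<partial>?M)"
    using nn_integral_Markov_inequality[of "\<lambda>\<omega>. ennreal (?T \<omega>)" "space ?M" ?M "ennreal (exp (- a))"]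
    by (simp cong: nn_integral_cong)
  also have "\<dots> \<le> ennreal (exp (- a)) * ennreal (?d * (1 + (exp t - 1) / ?d) ^ card I)"
    by (intro mult_left_mono expected_trace_exp_rank_one_sum assms) simp
  also have "\<dots> \<le> ennreal (exp (- a) * (?d * exp (real (card I) * (exp t - 1) / ?d)))"
  proof -
    have "(1 + (exp t - 1) / ?d) ^ card I \<le> exp ((exp t - 1) / ?d) ^ card I"
      by (intro power_mono factor exp_ge_add_one_self)
    then have "(1 + (exp t - 1) / ?d) ^ card I \<le> exp (real (card I) * (exp t - 1) / ?d)"
      by (simp add: exp_of_nat_mult[symmetric])
    then show ?thesis
      using factor by (simp add: ennreal_mult[symmetric] mult_left_mono)
  qed
  also have "exp (- a) * (?d * exp (real (card I) * (exp t - 1) / ?d)) = ?d * exp (real (card I) * (exp t - 1) / ?d - a)"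
    by (simp only: diff_conv_add_uminus exp_add mult_ac)
  finally show ?thesis .
qed

end

section \<open>Concentration of the empirical Gram matrix\<close>

lemma borel_measurable_vec:
  fixes f :: "'x \<Rightarrow> ('b::euclidean_space)^'m"
  assumes [measurable]: "\<And>i. (\<lambda>x. f x $ i) \<in> borel_measurable M"
  shows "f \<in> borel_measurable M"
proof (rule borel_measurable_euclidean_space[THEN iffD2], rule ballI)
  fix b :: "'b^'m" assume "b \<in> Basis"
  then obtain i u where "b = axis i u" by (auto simp: Basis_vec_def)
  then show "(\<lambda>x. f x \<bullet> b) \<in> borel_measurable M" by (simp add: inner_axis)
qed

lemma onorm_matrix_le_norm:
  fixes A :: "real^'n^'m"
  shows "onorm ((*v) A) \<le> real CARD('m) * real CARD('n) * norm A"
proof (rule onorm_le_matrix_component)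
  fix i j
  have "\<bar>A $ i $ j\<bar> \<le> norm (A $ i)" by (rule component_le_norm_cart)
  also have "\<dots> \<le> norm A" by (rule Finite_Cartesian_Product.norm_nth_le)
  finally show "\<bar>A $ i $ j\<bar> \<le> norm A" .
qed

text \<open>The operator norm is Lipschitz in the entries; hence the deviation of the Gram matrix is a random
  variable.\<close>

lemma continuous_onorm_matrix: "continuous_on UNIV (\<lambda>A::real^'n^'m. onorm ((*v) A))"
proof -
  let ?K = "real CARD('m) * real CARD('n)"
  have le: "onorm ((*v) A) \<le> onorm ((*v) B) + ?K * norm (A - B)" for A B :: "real^'n^'m"
  proof -
    have "onorm ((*v) A) = onorm (\<lambda>x. B *v x + (A - B) *v x)"
      by (simp add: matrix_vector_mult_add_rdistrib[symmetric])
    also have "\<dots> \<le> onorm ((*v) B) + onorm ((*v) (A - B))"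
      by (intro onorm_triangle) (auto simp: matrix_vector_mul_bounded_linear)
    finally show ?thesis using onorm_matrix_le_norm[of "A - B"] by linarith
  qed
  have "?K-lipschitz_on UNIV (\<lambda>A::real^'n^'m. onorm ((*v) A))"
  proof (rule lipschitz_onI)
    fix A B :: "real^'n^'m"
    show "dist (onorm ((*v) A)) (onorm ((*v) B)) \<le> ?K * dist A B"
      using le[of A B] le[of B A] by (simp add: dist_norm norm_minus_commute abs_le_iff)
  qed simp
  then show ?thesis by (rule lipschitz_on_continuous_on)
qed

text \<open>In the eigenbasis, \<open>(norm (f x))\<^sup>2\<close> is the sum of \<open>(l b)\<^sup>2\<close> with weights \<open>(x \<bullet> b)\<^sup>2\<close>, which add up
  to \<open>(norm x)\<^sup>2\<close>.\<close>

lemma onorm_le_eigenvalue_bound: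
  fixes f :: "'a::euclidean_space \<Rightarrow> 'a"
  assumes f: "selfadjoint f" and eb: "eigenbasis f B l" and l: "\<And>b. b \<in> B \<Longrightarrow> \<bar>l b\<bar> \<le> r"
    and r: "0 \<le> r"
  shows "onorm f \<le> r"
proof (rule onorm_le)
  fix x
  note lin = selfadjoint_linear[OF f]
  have "(norm (f x))\<^sup>2 = x \<bullet> (f ^^ 2) x"
    unfolding power2_norm_eq_inner using selfadjoint_swap[OF f, of x "f x"] by (simp add: numeral_2_eq_2)
  also have "\<dots> = (\<Sum>b\<in>B. (l b)\<^sup>2 * (x \<bullet> b)\<^sup>2)" by (rule eigenbasis_funpow_quadratic[OF lin eb])
  also have "\<dots> \<le> (\<Sum>b\<in>B. r\<^sup>2 * (x \<bullet> b)\<^sup>2)"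
    using l r by (intro sum_mono mult_right_mono) (auto simp: abs_le_square_iff[symmetric])
  also have "\<dots> = (r * norm x)\<^sup>2"
    using eigenbasis_inner[OF lin eb, of x x]
    by (simp add: sum_distrib_left[symmetric] power_mult_distrib dot_square_norm power2_eq_square)
  finally show "norm (f x) \<le> r * norm x"
    using r by (simp add: power2_le_iff_abs_le abs_le_square_iff[symmetric])
qed

definition feature :: "('m::finite \<Rightarrow> 'a \<Rightarrow> real) \<Rightarrow> 'a \<Rightarrow> real^'m" where
  "feature \<phi> x = (\<chi> j. \<phi> j x)"

abbreviation direction :: "('m::finite \<Rightarrow> 'a \<Rightarrow> real) \<Rightarrow> 'a \<Rightarrow> real^'m" where
  "direction \<phi> x \<equiv> sgn (feature \<phi> x)"

lemma feature_inner: "feature \<phi> x \<bullet> c = (\<Sum>j\<in>UNIV. c $ j * \<phi> j x)"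
  by (simp add: feature_def inner_vec_def mult.commute)

lemma inv_weight_eq: "inv_weight \<phi> x = (norm (feature \<phi> x))\<^sup>2 / real CARD('m)"
  for \<phi> :: "'m::finite \<Rightarrow> 'a \<Rightarrow> real"
  unfolding power2_norm_eq_inner
  by (simp add: inv_weight_def feature_def inner_vec_def power2_eq_square)

lemma weight_eq: "weight \<phi> x = real CARD('m) / (norm (feature \<phi> x))\<^sup>2"
  for \<phi> :: "'m::finite \<Rightarrow> 'a \<Rightarrow> real"
  by (simp add: weight_def inv_weight_eq)

lemma weight_nonneg: "0 \<le> weight \<phi> x"
  by (simp add: weight_eq)

lemma inv_weight_nonneg: "0 \<le> inv_weight \<phi> x"
  by (simp add: inv_weight_eq)

text \<open>Each summand of the Gram matrix is \<open>m\<close> times the projection onto the direction of the feature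
  vector. Where the features vanish, both sides are zero, since \<open>sgn 0 = 0\<close> and the weight is zero.\<close>

lemma weight_feature_product:
  fixes \<phi> :: "'m::finite \<Rightarrow> 'a \<Rightarrow> real"
  shows "weight \<phi> x * (\<phi> j x * (feature \<phi> x \<bullet> a))
    = real CARD('m) * ((direction \<phi> x \<bullet> a) *\<^sub>R direction \<phi> x) $ j"
  by (simp add: weight_eq sgn_div_norm power2_eq_square feature_def divide_inverse mult_ac)

lemma emp_gram_apply:
  fixes \<phi> :: "'m::finite \<Rightarrow> 'a \<Rightarrow> real"
  shows "emp_gram \<phi> n x *v a
    = (real CARD('m) / real n) *\<^sub>R rank_one_sum 1 {1..n} (\<lambda>i. direction \<phi> (x i)) a"
proof (rule vec_eq_iff[THEN iffD2], rule allI)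
  fix j
  have "(emp_gram \<phi> n x *v a) $ j
      = (\<Sum>k\<in>UNIV. \<Sum>i=1..n. weight \<phi> (x i) * \<phi> j (x i) * \<phi> k (x i) * a $ k) / real n"
    by (simp add: emp_gram_def matrix_vector_mult_def sum_divide_distrib sum_distrib_right)
  also have "(\<Sum>k\<in>UNIV. \<Sum>i=1..n. weight \<phi> (x i) * \<phi> j (x i) * \<phi> k (x i) * a $ k)
      = (\<Sum>i=1..n. weight \<phi> (x i) * (\<phi> j (x i) * (feature \<phi> (x i) \<bullet> a)))"
    by (subst sum.swap) (simp add: feature_inner sum_distrib_left mult_ac)
  finally show "(emp_gram \<phi> n x *v a) $ j
      = ((real CARD('m) / real n) *\<^sub>R rank_one_sum 1 {1..n} (\<lambda>i. direction \<phi> (x i)) a) $ j"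
    unfolding weight_feature_product
    by (simp add: rank_one_sum_def sum_component sum_distrib_left sum_divide_distrib)
qed

lemma rank_one_sum_scale: "rank_one_sum t I w x = t *\<^sub>R rank_one_sum 1 I w x"
  by (simp add: rank_one_sum_def scaleR_sum_right)

text \<open>If the Gram matrix is off by more than \<open>\<delta>\<close>, it has an eigenvalue above \<open>1 + \<delta>\<close> or below
  \<open>1 - \<delta>\<close>, and the exponential with the corresponding sign of \<open>t\<close> detects it.\<close>

lemma large_gram_dev_imp_large_trace_exp:
  fixes \<phi> :: "'m::finite \<Rightarrow> 'a \<Rightarrow> real"
  assumes dev: "\<delta> < gram_dev \<phi> n x" and n: "0 < n" and \<delta>: "0 \<le> \<delta>" and s: "0 \<le> s" and t: "t \<le> 0"
  defines "T \<equiv> \<lambda>t. trace_exp (rank_one_sum t {1..n} (\<lambda>i. direction \<phi> (x i)))"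
  shows "exp (s * (1 + \<delta>) * real n / real CARD('m)) \<le> T s
    \<or> exp (t * (1 - \<delta>) * real n / real CARD('m)) \<le> T t"
proof -
  let ?m = "real CARD('m)" and ?n = "real n"
  let ?R = "\<lambda>t. rank_one_sum t {1..n} (\<lambda>i. direction \<phi> (x i))"
  define f where "f a = (emp_gram \<phi> n x - mat 1) *v a" for a
  have f_eq: "f a = (?m / ?n) *\<^sub>R ?R 1 a - a" for a
    by (simp add: f_def matrix_vector_mult_diff_rdistrib emp_gram_apply)
  note R = selfadjoint_rank_one_sum[of "{1..n}"]
  have "selfadjoint f"
    unfolding selfadjoint_def
  proof (intro conjI allI)
    show "linear f" unfolding f_def by simp
    show "f a \<bullet> b = a \<bullet> f b" for a b
      using selfadjoint_swap[OF R, of 1 "\<lambda>i. direction \<phi> (x i)" a b] by (simp add: f_eq inner_diff)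
  qed
  then obtain B l where eb: "eigenbasis f B l" using selfadjoint_has_eigenbasis by blast
  have "gram_dev \<phi> n x = onorm f" by (simp add: gram_dev_def f_def[abs_def])
  with dev onorm_le_eigenvalue_bound[OF \<open>selfadjoint f\<close> eb _ \<delta>]
  obtain b where b: "b \<in> B" "\<delta> < \<bar>l b\<bar>" by force
  have "exp (r * (1 + l b) * ?n / ?m) \<le> T r" for r
  proof -
    have "eigenbasis (?R r) B (\<lambda>b. r * (1 + l b) * ?n / ?m)"
      unfolding eigenbasis_def
    proof (intro conjI ballI)
      fix c assume "c \<in> B"
      then have "(?m / ?n) *\<^sub>R ?R 1 c = (1 + l c) *\<^sub>R c"
        using eb f_eq[of c] by (simp add: eigenbasis_def algebra_simps)
      then have "(r * ?n / ?m) *\<^sub>R (?m / ?n) *\<^sub>R ?R 1 c = (r * ?n / ?m) *\<^sub>R (1 + l c) *\<^sub>R c" by simp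
      then show "?R r c = (r * (1 + l c) * ?n / ?m) *\<^sub>R c"
        using n by (subst rank_one_sum_scale) (simp add: mult_ac)
    qed (use eb in \<open>auto simp: eigenbasis_def\<close>)
    from trace_exp_ge_eigenvalue[OF selfadjoint_linear[OF R] this b(1)] show ?thesis
      by (simp add: T_def)
  qed
  moreover have "s * (1 + \<delta>) * ?n / ?m \<le> s * (1 + l b) * ?n / ?m" if "\<delta> < l b"
    using that s by (intro divide_right_mono mult_right_mono mult_left_mono) auto
  moreover have "t * (1 - \<delta>) * ?n / ?m \<le> t * (1 + l b) * ?n / ?m" if "l b < - \<delta>"
    using that t by (intro divide_right_mono mult_right_mono mult_left_mono_neg) auto
  moreover have "\<delta> < l b \<or> l b < - \<delta>" using b by linarith
  ultimately show ?thesis by (meson exp_le_cancel_iff order_trans)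
qed

lemma d_const_pos:
  assumes "0 < \<delta>" shows "0 < d_const \<delta>"
proof -
  have "ln (1 / (1 + \<delta>)) \<noteq> 1 / (1 + \<delta>) - 1"
    using assms ln_eq_minus_one[of "1 / (1 + \<delta>)"] by auto
  moreover have "ln (1 / (1 + \<delta>)) \<le> 1 / (1 + \<delta>) - 1"
    using assms by (intro ln_le_minus_one) auto
  ultimately have "- ln (1 + \<delta>) < 1 / (1 + \<delta>) - 1"
    using assms by (simp add: ln_div)
  then have "- ln (1 + \<delta>) * (1 + \<delta>) < (1 / (1 + \<delta>) - 1) * (1 + \<delta>)"
    using assms by (intro mult_strict_right_mono) auto
  also have "(1 / (1 + \<delta>) - 1) * (1 + \<delta>) = - \<delta>" using assms by (simp add: field_simps)
  finally show ?thesis by (simp add: d_const_def algebra_simps)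
qed

text \<open>The lower tail decays at least as fast as the upper one: the difference of the two exponents
  vanishes at \<open>0\<close> and has derivative \<open>- ln (1 - x\<^sup>2) \<ge> 0\<close>.\<close>

lemma d_const_le_lower_exponent:
  assumes "0 < \<delta>" "\<delta> < 1"
  shows "d_const \<delta> \<le> (1 - \<delta>) * ln (1 - \<delta>) + \<delta>"
proof -
  define h where "h x = (1 - x) * ln (1 - x) + x - d_const x" for x :: real
  have "h 0 \<le> h \<delta>"
  proof (rule DERIV_nonneg_imp_nondecreasing[of 0 \<delta> h])
    fix x assume x: "0 \<le> x" "x \<le> \<delta>"
    then have x1: "x < 1" using assms by simp
    have "(h has_real_derivative (- ln (1 - x) - ln (1 + x))) (at x)"
      unfolding h_def d_const_def using x x1 by (auto intro!: derivative_eq_intros)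
    moreover have "ln (1 - x) + ln (1 + x) = ln ((1 - x) * (1 + x))"
      using x x1 by (simp add: ln_mult_pos)
    moreover have "ln ((1 - x) * (1 + x)) \<le> 0"
    proof -
      have "0 < (1 - x) * (1 + x)" using x x1 by (intro mult_pos_pos) auto
      moreover have "(1 - x) * (1 + x) \<le> 1" by (simp add: algebra_simps)
      ultimately show ?thesis by simp
    qed
    ultimately show "\<exists>y. (h has_real_derivative y) (at x) \<and> 0 \<le> y" by force
  qed (use assms in simp)
  then show ?thesis by (simp add: h_def d_const_def)
qed

section \<open>The sampling measure and the stability of one sample\<close>

locale L2_orthonormal_system = prob_space \<mu> for \<mu> :: "'a measure" +
  fixes \<phi> :: "'m::finite \<Rightarrow> 'a \<Rightarrow> real"
  assumes orthonormal: "L2_orthonormal \<mu> \<phi>"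
begin

abbreviation "\<rho> \<equiv> sampling_measure \<mu> \<phi>"

lemma basis_L2: "\<phi> j \<in> L2 \<mu>"
  using orthonormal by (simp add: L2_orthonormal_def)

lemma basis_measurable[measurable]: "\<phi> j \<in> borel_measurable \<mu>"
  using basis_L2[of j] by (simp add: L2_def)

lemma L2_product_integrable:
  assumes "u \<in> L2 \<mu>" "v \<in> L2 \<mu>" shows "integrable \<mu> (\<lambda>x. u x * v x)"
proof (rule Bochner_Integration.integrable_bound)
  show "integrable \<mu> (\<lambda>x. (u x)\<^sup>2 + (v x)\<^sup>2)" using assms by (auto simp: L2_def)
  have "\<bar>u x * v x\<bar> \<le> (u x)\<^sup>2 + (v x)\<^sup>2" for x
    using sum_squares_bound[of "\<bar>u x\<bar>" "\<bar>v x\<bar>"] abs_ge_zero[of "u x * v x"]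
    unfolding power2_abs abs_mult by linarith
  then show "AE x in \<mu>. norm (u x * v x) \<le> norm ((u x)\<^sup>2 + (v x)\<^sup>2)" by simp
  show "(\<lambda>x. u x * v x) \<in> borel_measurable \<mu>" using assms by (auto simp: L2_def)
qed

lemma basis_product_integral: "(LINT x|\<mu>. \<phi> i x * \<phi> j x) = (if i = j then 1 else 0)"
  using orthonormal by (simp add: L2_orthonormal_def L2_inner_def)

lemma feature_measurable[measurable]: "feature \<phi> \<in> borel_measurable \<mu>"
  by (rule borel_measurable_vec) (simp add: feature_def)

lemma inv_weight_measurable[measurable]: "inv_weight \<phi> \<in> borel_measurable \<mu>"
  unfolding inv_weight_eq[abs_def] by measurable

lemma weight_measurable[measurable]: "weight \<phi> \<in> borel_measurable \<mu>"
  unfolding weight_eq[abs_def] by measurable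

lemma feature_inner_square:
  "integrable \<mu> (\<lambda>x. (feature \<phi> x \<bullet> c)\<^sup>2)" "(LINT x|\<mu>. (feature \<phi> x \<bullet> c)\<^sup>2) = (norm c)\<^sup>2"
proof -
  have eq: "(feature \<phi> x \<bullet> c)\<^sup>2 = (\<Sum>i\<in>UNIV. \<Sum>j\<in>UNIV. (c $ i * c $ j) * (\<phi> i x * \<phi> j x))" for x
    by (simp add: feature_inner power2_eq_square sum_product mult_ac)
  show "integrable \<mu> (\<lambda>x. (feature \<phi> x \<bullet> c)\<^sup>2)"
    unfolding eq by (intro Bochner_Integration.integrable_sum integrable_mult_right L2_product_integrable basis_L2)
  have "(LINT x|\<mu>. (feature \<phi> x \<bullet> c)\<^sup>2) = (\<Sum>i\<in>UNIV. \<Sum>j\<in>UNIV. (c $ i * c $ j) * (LINT x|\<mu>. \<phi> i x * \<phi> j x))"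
    unfolding eq
    by (simp add: Bochner_Integration.integral_sum Bochner_Integration.integrable_sum
        L2_product_integrable basis_L2)
  also have "\<dots> = (norm c)\<^sup>2"
    unfolding basis_product_integral
    by (simp add: if_distrib cong: if_cong) (simp add: power2_norm_eq_inner inner_vec_def)
  finally show "(LINT x|\<mu>. (feature \<phi> x \<bullet> c)\<^sup>2) = (norm c)\<^sup>2" .
qed

lemma inv_weight_integral: "integrable \<mu> (inv_weight \<phi>)" "(LINT x|\<mu>. inv_weight \<phi> x) = 1"
proof -
  have i: "integrable \<mu> (\<lambda>x. (\<phi> j x)\<^sup>2)" for j
    using basis_L2[of j] by (simp add: L2_def)
  then show "integrable \<mu> (inv_weight \<phi>)" unfolding inv_weight_def[abs_def] by simp
  have "(LINT x|\<mu>. (\<phi> j x)\<^sup>2) = 1" for j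
    using basis_product_integral[of j j] by (simp add: power2_eq_square)
  then show "(LINT x|\<mu>. inv_weight \<phi> x) = 1"
    unfolding inv_weight_def[abs_def] using i by (simp add: Bochner_Integration.integral_sum)
qed

lemma sets_sampling[measurable_cong, simp]: "sets \<rho> = sets \<mu>"
  by (simp add: sampling_measure_def)

lemma space_sampling[simp]: "space \<rho> = space \<mu>"
  by (simp add: sampling_measure_def)

lemma prob_space_sampling: "prob_space \<rho>"
proof (rule prob_spaceI)
  have "emeasure \<rho> (space \<rho>) = (\<integral>\<^sup>+x. ennreal (inv_weight \<phi> x) \<partial>\<mu>)"
    by (simp add: sampling_measure_def emeasure_density cong: nn_integral_cong)
  also have "\<dots> = 1"
    using inv_weight_integral by (simp add: nn_integral_eq_integral inv_weight_nonneg)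
  finally show "emeasure \<rho> (space \<rho>) = 1" .
qed

lemma direction_measurable: "direction \<phi> \<in> borel_measurable \<rho>"
proof -
  have "direction \<phi> \<in> borel_measurable \<mu>" unfolding sgn_div_norm by measurable
  then show ?thesis by (simp add: sampling_measure_def)
qed

sublocale dir: isotropic_directions \<rho> "direction \<phi>"
proof (intro isotropic_directions.intro isotropic_directions_axioms.intro prob_space_sampling direction_measurable)
  show "norm (direction \<phi> x) = 1 \<or> direction \<phi> x = 0" for x by (auto simp: norm_sgn sgn_zero_iff)
  have "inv_weight \<phi> x * (direction \<phi> x \<bullet> e)\<^sup>2 = (feature \<phi> x \<bullet> e)\<^sup>2 / real CARD('m)" for x e
    by (cases "feature \<phi> x = 0") (simp_all add: inv_weight_eq sgn_div_norm power_mult_distrib power_divide field_simps)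
  moreover have "(LINT x|\<rho>. (direction \<phi> x \<bullet> e)\<^sup>2) = (LINT x|\<mu>. inv_weight \<phi> x * (direction \<phi> x \<bullet> e)\<^sup>2)" for e
  proof -
    have "(\<lambda>x. (direction \<phi> x \<bullet> e)\<^sup>2) \<in> borel_measurable \<mu>" unfolding sgn_div_norm by measurable
    then show ?thesis
      unfolding sampling_measure_def by (subst integral_density) (auto simp: inv_weight_nonneg)
  qed
  ultimately show "(LINT x|\<rho>. (direction \<phi> x \<bullet> e)\<^sup>2) = (norm e)\<^sup>2 / real DIM(real^'m)" for e
    by (simp add: feature_inner_square)
qed

text \<open>The weight undoes the sampling density where it is positive. Where it vanishes, the contribution
  of \<open>v\<close> is lost, whence an inequality.\<close>

lemma weighted_square_expectation:
  assumes [measurable]: "v \<in> borel_measurable \<mu>"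
  shows "(\<integral>\<^sup>+x. ennreal (weight \<phi> x * (v x)\<^sup>2) \<partial>\<rho>) \<le> (\<integral>\<^sup>+x. ennreal ((v x)\<^sup>2) \<partial>\<mu>)"
proof -
  have "inv_weight \<phi> x * (weight \<phi> x * (v x)\<^sup>2) \<le> (v x)\<^sup>2" for x
    by (simp add: weight_def)
  then show ?thesis
    unfolding sampling_measure_def
    by (subst nn_integral_density)
      (auto intro!: nn_integral_mono ennreal_leI simp: ennreal_mult[symmetric] inv_weight_nonneg weight_nonneg)
qed

abbreviation "sample_space n \<equiv> sample_measure \<mu> \<phi> n"

lemma prob_space_sample: "prob_space (sample_space n)"
  unfolding sample_measure_def by (intro prob_space_PiM prob_space_sampling)

lemma sample_component_measurable:
  "i \<in> {1..n} \<Longrightarrow> (\<lambda>x. x i) \<in> measurable (sample_space n) \<mu>"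
  unfolding sample_measure_def
  by (subst measurable_cong_sets[OF refl sets_sampling[symmetric]]) simp

lemma sample_eval_measurable:
  "g \<in> borel_measurable \<mu> \<Longrightarrow> i \<in> {1..n} \<Longrightarrow> (\<lambda>x. g (x i)) \<in> borel_measurable (sample_space n)"
  by (rule measurable_compose[OF sample_component_measurable])

lemma gram_dev_measurable[measurable]: "gram_dev \<phi> n \<in> borel_measurable (sample_space n)"
proof -
  have "emp_gram \<phi> n \<in> borel_measurable (sample_space n)"
    unfolding emp_gram_def[abs_def]
    by (intro borel_measurable_vec)
      (simp only: vec_lambda_beta,
       intro borel_measurable_divide borel_measurable_sum borel_measurable_times borel_measurable_const
         sample_eval_measurable[OF weight_measurable] sample_eval_measurable[OF basis_measurable])
  moreover have "continuous_on UNIV (\<lambda>A::real^'m^'m. onorm ((*v) (A - mat 1)))"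
    by (rule continuous_on_compose2[OF continuous_onorm_matrix]) (auto intro!: continuous_intros)
  note borel_measurable_continuous_onI[OF this]
  ultimately show ?thesis
    unfolding gram_dev_def[abs_def] by (rule measurable_compose)
qed

text \<open>A union bound over the two eigenvalue tails. The choices \<open>t = ln (1 + \<delta>)\<close> and \<open>t = ln (1 - \<delta>)\<close>
  minimise the exponents \<open>n (e^t - 1) / m - t (1 + \<delta>) n / m\<close> and \<open>n (e^t - 1) / m - t (1 - \<delta>) n / m\<close>.\<close>

lemma gram_dev_tail:
  assumes \<delta>: "0 < \<delta>" "\<delta> < 1" and n: "0 < n"
  shows "emeasure (sample_space n) {x \<in> space (sample_space n). \<delta> < gram_dev \<phi> n x}
    \<le> ennreal (2 * real CARD('m) * exp (- (real n * d_const \<delta> / real CARD('m))))"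
proof -
  let ?M = "sample_space n"
  define s t where "s = ln (1 + \<delta>)" and "t = ln (1 - \<delta>)"
  define T where "T r x = trace_exp (rank_one_sum r {1..n} (\<lambda>i. direction \<phi> (x i)))" for r and x :: "nat \<Rightarrow> 'a"
  have [measurable]: "T r \<in> borel_measurable ?M" for r
    unfolding T_def[abs_def] sample_measure_def
    by (intro trace_exp_rank_one_sum_measurable dir.V_component_measurable)
  have tail: "emeasure ?M {x \<in> space ?M. exp a \<le> T r x} \<le> ennreal (real CARD('m) * exp (- (real n * d_const \<delta> / real CARD('m))))"
    if "real n * (exp r - 1) / real CARD('m) - a \<le> - (real n * d_const \<delta> / real CARD('m))" for a r
  proof -
    have "emeasure ?M {x \<in> space ?M. exp a \<le> T r x} \<le> ennreal (real CARD('m) * exp (real n * (exp r - 1) / real CARD('m) - a))"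
      using dir.trace_exp_rank_one_sum_tail[of "{1..n}" a r] by (simp add: T_def sample_measure_def)
    also have "\<dots> \<le> ennreal (real CARD('m) * exp (- (real n * d_const \<delta> / real CARD('m))))"
      using that by (intro ennreal_leI mult_left_mono) auto
    finally show ?thesis .
  qed
  have "{x \<in> space ?M. \<delta> < gram_dev \<phi> n x}
      \<subseteq> {x \<in> space ?M. exp (s * (1 + \<delta>) * real n / real CARD('m)) \<le> T s x}
        \<union> {x \<in> space ?M. exp (t * (1 - \<delta>) * real n / real CARD('m)) \<le> T t x}"
    using large_gram_dev_imp_large_trace_exp[of \<delta> \<phi> n _ s t] \<delta> n by (auto simp: T_def s_def t_def)
  then have "emeasure ?M {x \<in> space ?M. \<delta> < gram_dev \<phi> n x}
      \<le> emeasure ?M {x \<in> space ?M. exp (s * (1 + \<delta>) * real n / real CARD('m)) \<le> T s x}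
        + emeasure ?M {x \<in> space ?M. exp (t * (1 - \<delta>) * real n / real CARD('m)) \<le> T t x}"
    by (intro order_trans[OF emeasure_mono emeasure_subadditive]) auto
  also have "\<dots> \<le> ennreal (real CARD('m) * exp (- (real n * d_const \<delta> / real CARD('m)))) + ennreal (real CARD('m) * exp (- (real n * d_const \<delta> / real CARD('m))))"
  proof (intro add_mono tail)
    have "real n * (exp s - 1) / real CARD('m) - s * (1 + \<delta>) * real n / real CARD('m) = - (real n * d_const \<delta> / real CARD('m))"
      using \<delta> by (simp add: s_def d_const_def field_simps)
    then show "real n * (exp s - 1) / real CARD('m) - s * (1 + \<delta>) * real n / real CARD('m) \<le> - (real n * d_const \<delta> / real CARD('m))" by simp
    have le: "real n / real CARD('m) * d_const \<delta> \<le> real n / real CARD('m) * ((1 - \<delta>) * ln (1 - \<delta>) + \<delta>)"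
      by (intro mult_left_mono d_const_le_lower_exponent \<delta>) simp
    then show "real n * (exp t - 1) / real CARD('m) - t * (1 - \<delta>) * real n / real CARD('m) \<le> - (real n * d_const \<delta> / real CARD('m))"
    proof -
      have eq: "N * ((1 - \<delta>) - 1) / M - l * (1 - \<delta>) * N / M = - (N / M * ((1 - \<delta>) * l + \<delta>))" for N M l :: real
        unfolding divide_inverse by algebra
      have exp_t: "exp t = 1 - \<delta>" using \<delta> by (simp add: t_def)
      have "real n * (exp t - 1) / real CARD('m) - t * (1 - \<delta>) * real n / real CARD('m)
          = - (real n / real CARD('m) * ((1 - \<delta>) * ln (1 - \<delta>) + \<delta>))"
        unfolding exp_t t_def[symmetric] by (rule eq)
      then show ?thesis using le by (simp only: neg_le_iff_le times_divide_eq_left)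
    qed
  qed
  also have "\<dots> = ennreal (2 * real CARD('m) * exp (- (real n * d_const \<delta> / real CARD('m))))"
    unfolding mult.assoc[of 2] mult_2[of "_ * _"] by (intro ennreal_plus[symmetric] mult_nonneg_nonneg) simp_all
  finally show ?thesis .
qed

lemma enough_samples_stability:
  assumes \<delta>: "0 < \<delta>" "\<delta> < 1" and \<eta>: "0 < \<eta>" "\<eta> < 1"
    and n: "real n \<ge> inverse (d_const \<delta>) * real CARD('m) * ln (2 * real CARD('m) * inverse \<eta>)"
  shows "0 < n"
    and "emeasure (sample_space n) {x \<in> space (sample_space n). \<delta> < gram_dev \<phi> n x} \<le> ennreal \<eta>"
proof -
  have card: "1 \<le> real CARD('m)" by (simp add: Suc_leI)
  have "\<eta> < 2 * real CARD('m)" using card \<eta> by linarith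
  then have "1 < 2 * real CARD('m) * inverse \<eta>" using \<eta> by (simp add: field_simps)
  then have ln: "0 < ln (2 * real CARD('m) * inverse \<eta>)" by (rule ln_gt_zero)
  have d: "0 < d_const \<delta>" by (rule d_const_pos[OF \<delta>(1)])
  have "0 < inverse (d_const \<delta>) * real CARD('m) * ln (2 * real CARD('m) * inverse \<eta>)" using d card ln by simp
  with n show n0: "0 < n" by linarith
  have "ln (2 * real CARD('m) * inverse \<eta>) \<le> real n * d_const \<delta> / real CARD('m)"
    using n d card by (simp add: field_simps)
  then have "exp (ln (2 * real CARD('m) * inverse \<eta>)) \<le> exp (real n * d_const \<delta> / real CARD('m))"
    by simp
  then have "2 * real CARD('m) * inverse \<eta> \<le> exp (real n * d_const \<delta> / real CARD('m))"
    unfolding exp_ln[OF order.strict_trans[OF zero_less_one \<open>1 < 2 * real CARD('m) * inverse \<eta>\<close>]] .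
  then have "2 * real CARD('m) * exp (- (real n * d_const \<delta> / real CARD('m))) \<le> \<eta>"
    using \<eta> by (simp add: exp_minus field_simps)
  then show "emeasure (sample_space n) {x \<in> space (sample_space n). \<delta> < gram_dev \<phi> n x} \<le> ennreal \<eta>"
    by (intro order_trans[OF gram_dev_tail[OF \<delta> n0]] ennreal_leI)
qed

end

section \<open>Stability of the weighted least-squares projection\<close>

definition emp_inner :: "('m::finite \<Rightarrow> 'a \<Rightarrow> real) \<Rightarrow> nat \<Rightarrow> (nat \<Rightarrow> 'a) \<Rightarrow> ('a \<Rightarrow> real) \<Rightarrow> ('a \<Rightarrow> real) \<Rightarrow> real" where
  "emp_inner \<phi> n x u v = (\<Sum>i=1..n. weight \<phi> (x i) * u (x i) * v (x i)) / real n"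

abbreviation lincomb :: "('m::finite \<Rightarrow> 'a \<Rightarrow> real) \<Rightarrow> real^'m \<Rightarrow> 'a \<Rightarrow> real" where
  "lincomb \<phi> c \<equiv> (\<lambda>t. feature \<phi> t \<bullet> c)"

lemma emp_inner_nonneg: "0 \<le> emp_inner \<phi> n x v v"
  unfolding emp_inner_def
  by (intro divide_nonneg_nonneg sum_nonneg) (simp_all add: mult.assoc weight_nonneg)

lemma emp_norm_eq: "emp_norm \<phi> n x v = sqrt (emp_inner \<phi> n x v v)"
  by (simp add: emp_norm_def emp_inner_def power2_eq_square mult.assoc)

lemma emp_inner_diff:
  "emp_inner \<phi> n x (\<lambda>t. u t - v t) (\<lambda>t. u t - v t)
    = emp_inner \<phi> n x u u - 2 * emp_inner \<phi> n x u v + emp_inner \<phi> n x v v"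
proof -
  have "weight \<phi> y * (u y - v y) * (u y - v y)
      = weight \<phi> y * u y * u y - 2 * (weight \<phi> y * u y * v y) + weight \<phi> y * v y * v y" for y
    by (simp add: algebra_simps)
  then show ?thesis
    by (simp add: emp_inner_def sum.distrib sum_subtractf sum_distrib_left[symmetric]
        add_divide_distrib diff_divide_distrib)
qed

lemma emp_inner_diff_left:
  "emp_inner \<phi> n x (\<lambda>t. u t - v t) w = emp_inner \<phi> n x u w - emp_inner \<phi> n x v w"
  by (simp add: emp_inner_def sum_subtractf diff_divide_distrib algebra_simps)

lemma emp_inner_lincomb_right:
  "emp_inner \<phi> n x u (lincomb \<phi> c) = (\<Sum>j\<in>UNIV. c $ j * emp_inner \<phi> n x u (\<phi> j))"
proof -
  have "(\<Sum>i=1..n. weight \<phi> (x i) * u (x i) * lincomb \<phi> c (x i))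
      = (\<Sum>j\<in>UNIV. \<Sum>i=1..n. c $ j * (weight \<phi> (x i) * u (x i) * \<phi> j (x i)))"
    by (subst sum.swap) (simp add: feature_inner sum_distrib_left mult_ac)
  then show ?thesis
    by (simp add: emp_inner_def sum_distrib_left sum_divide_distrib)
qed

definition emp_moments :: "('m::finite \<Rightarrow> 'a \<Rightarrow> real) \<Rightarrow> nat \<Rightarrow> (nat \<Rightarrow> 'a) \<Rightarrow> ('a \<Rightarrow> real) \<Rightarrow> real^'m" where
  "emp_moments \<phi> n x u = (\<chi> j. emp_inner \<phi> n x u (\<phi> j))"

lemma emp_inner_lincomb: "emp_inner \<phi> n x u (lincomb \<phi> c) = c \<bullet> emp_moments \<phi> n x u"
  unfolding emp_inner_lincomb_right by (simp add: emp_moments_def inner_vec_def)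

lemma emp_moments_lincomb: "emp_moments \<phi> n x (lincomb \<phi> c) = emp_gram \<phi> n x *v c"
proof (rule vec_eq_iff[THEN iffD2], rule allI)
  fix j
  have "emp_inner \<phi> n x (lincomb \<phi> c) (\<phi> j) = emp_inner \<phi> n x (\<phi> j) (lincomb \<phi> c)"
    by (simp add: emp_inner_def mult_ac)
  also have "\<dots> = (\<Sum>k\<in>UNIV. emp_gram \<phi> n x $ j $ k * c $ k)"
    unfolding emp_inner_lincomb_right
    by (simp add: emp_inner_def emp_gram_def mult.commute)
  finally show "emp_moments \<phi> n x (lincomb \<phi> c) $ j = (emp_gram \<phi> n x *v c) $ j"
    by (simp add: emp_moments_def matrix_vector_mult_def)
qed

lemma emp_inner_lincombs:
  "emp_inner \<phi> n x (lincomb \<phi> c) (lincomb \<phi> c) = c \<bullet> (emp_gram \<phi> n x *v c)"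
  by (simp add: emp_inner_lincomb emp_moments_lincomb)

lemma emp_gram_coercive:
  assumes "gram_dev \<phi> n x \<le> \<delta>"
  shows "(1 - \<delta>) * (norm c)\<^sup>2 \<le> c \<bullet> (emp_gram \<phi> n x *v c)"
proof -
  let ?A = "emp_gram \<phi> n x - mat 1"
  have "norm (?A *v c) \<le> gram_dev \<phi> n x * norm c"
    unfolding gram_dev_def by (rule onorm[OF matrix_vector_mul_bounded_linear])
  also have "\<dots> \<le> \<delta> * norm c" using assms by (intro mult_right_mono) auto
  finally have "norm c * norm (?A *v c) \<le> norm c * (\<delta> * norm c)" by (intro mult_left_mono) auto
  then have "\<bar>c \<bullet> (?A *v c)\<bar> \<le> \<delta> * (norm c)\<^sup>2"
    using Cauchy_Schwarz_ineq2[of c "?A *v c"] by (simp add: power2_eq_square mult_ac)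
  moreover have "c \<bullet> (emp_gram \<phi> n x *v c) = (norm c)\<^sup>2 + c \<bullet> (?A *v c)"
    by (simp add: matrix_vector_mult_diff_rdistrib inner_diff_right power2_norm_eq_inner)
  ultimately show ?thesis unfolding left_diff_distrib by linarith
qed

lemma fspan_eq: "fspan \<phi> = range (lincomb \<phi>)"
proof -
  have "\<exists>b. v = lincomb \<phi> b" if "v \<in> fspan \<phi>" for v
  proof -
    from that obtain c where "v = (\<lambda>x. \<Sum>j\<in>UNIV. c j * \<phi> j x)" by (auto simp: fspan_def)
    then have "v = lincomb \<phi> (\<chi> j. c j)" by (simp add: feature_inner)
    then show ?thesis by blast
  qed
  moreover have "lincomb \<phi> c \<in> fspan \<phi>" for c
    unfolding fspan_def feature_inner by blast
  ultimately show ?thesis by blast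
qed

text \<open>Completing the square: the normal equations have a unique solution because the Gram matrix
  is coercive, and the excess over the minimum is a positive definite quadratic form.\<close>

lemma ls_proj_normal_equation:
  assumes dev: "gram_dev \<phi> n x \<le> \<delta>" and \<delta>: "\<delta> < 1"
  obtains c where "ls_proj \<phi> n x u = lincomb \<phi> c" "emp_gram \<phi> n x *v c = emp_moments \<phi> n x u"
proof -
  let ?G = "emp_gram \<phi> n x"
  let ?J = "\<lambda>v. emp_norm \<phi> n x (\<lambda>t. u t - v t)"
  have pos: "c = 0" if "c \<bullet> (?G *v c) \<le> 0" for c
  proof -
    have "(1 - \<delta>) * (norm c)\<^sup>2 \<le> 0" using emp_gram_coercive[OF dev, of c] that by linarith
    then show ?thesis using \<delta> by (simp add: mult_le_0_iff)
  qed
  have "inj ((*v) ?G)"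
  proof (rule injI)
    fix a b assume "?G *v a = ?G *v b"
    then have "?G *v (a - b) = 0" by (simp add: matrix_vector_mult_diff_distrib)
    then show "a = b" using pos[of "a - b"] by simp
  qed
  then have "surj ((*v) ?G)"
    by (intro linear_injective_imp_surjective[OF matrix_vector_mul_linear]) simp_all
  then obtain c where c: "?G *v c = emp_moments \<phi> n x u" by (metis surjD)
  have excess: "emp_inner \<phi> n x (\<lambda>t. u t - lincomb \<phi> b t) (\<lambda>t. u t - lincomb \<phi> b t)
      = emp_inner \<phi> n x (\<lambda>t. u t - lincomb \<phi> c t) (\<lambda>t. u t - lincomb \<phi> c t) + (b - c) \<bullet> (?G *v (b - c))" for b
  proof -
    have "c \<bullet> (?G *v b) = b \<bullet> (?G *v c)"
      unfolding emp_moments_lincomb[symmetric] emp_inner_lincomb[symmetric]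
      by (simp add: emp_inner_def mult_ac)
    then show ?thesis
      unfolding emp_inner_diff emp_inner_lincomb emp_moments_lincomb c[symmetric]
        matrix_vector_mult_diff_distrib inner_diff_left inner_diff_right by linarith
  qed
  have G0: "0 \<le> b \<bullet> (?G *v b)" for b
    using emp_inner_nonneg[of \<phi> n x "lincomb \<phi> b"] by (simp add: emp_inner_lincombs)
  have "?J (lincomb \<phi> c) \<le> ?J (lincomb \<phi> b)" for b
    unfolding emp_norm_eq real_sqrt_le_iff excess[of b] using G0[of "b - c"] by linarith
  then have "is_arg_min ?J (\<lambda>v. v \<in> fspan \<phi>) (lincomb \<phi> c)"
    by (auto simp: is_arg_min_def fspan_eq not_less)
  then have min: "is_arg_min ?J (\<lambda>v. v \<in> fspan \<phi>) (ls_proj \<phi> n x u)"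
    unfolding ls_proj_def arg_min_on_def arg_min_def
    by (rule someI[of "is_arg_min ?J (\<lambda>v. v \<in> fspan \<phi>)"])
  then obtain b where b: "ls_proj \<phi> n x u = lincomb \<phi> b"
    by (auto simp: is_arg_min_def fspan_eq)
  have "\<not> ?J (lincomb \<phi> c) < ?J (lincomb \<phi> b)"
    using min unfolding b by (auto simp: is_arg_min_def fspan_eq)
  then have "(b - c) \<bullet> (?G *v (b - c)) \<le> 0"
    unfolding emp_norm_eq real_sqrt_less_iff excess[of b] by linarith
  from pos[OF this] have "b = c" by simp
  with b c show ?thesis by (intro that) auto
qed

context L2_orthonormal_system
begin

lemma lincomb_L2: "lincomb \<phi> c \<in> L2 \<mu>"
proof -
  have "lincomb \<phi> c \<in> borel_measurable \<mu>" by measurable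
  then show ?thesis by (simp add: L2_def feature_inner_square)
qed

lemma L2_diff: "u \<in> L2 \<mu> \<Longrightarrow> v \<in> L2 \<mu> \<Longrightarrow> (\<lambda>t. u t - v t) \<in> L2 \<mu>"
  using L2_product_integrable[of u v]
  by (auto simp: L2_def power2_diff mult.assoc)

definition proj_coeffs :: "('a \<Rightarrow> real) \<Rightarrow> real^'m" where
  "proj_coeffs u = (\<chi> j. L2_inner \<mu> u (\<phi> j))"

lemma L2_proj_eq: "L2_proj \<mu> \<phi> u = lincomb \<phi> (proj_coeffs u)"
  by (simp add: L2_proj_def feature_inner proj_coeffs_def)

lemma L2_norm_square: "(L2_norm \<mu> v)\<^sup>2 = (LINT x|\<mu>. (v x)\<^sup>2)"
  by (simp add: L2_norm_def L2_inner_def power2_eq_square)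

abbreviation residual :: "('a \<Rightarrow> real) \<Rightarrow> 'a \<Rightarrow> real" where
  "residual u \<equiv> (\<lambda>t. u t - L2_proj \<mu> \<phi> u t)"

lemma residual_L2: "u \<in> L2 \<mu> \<Longrightarrow> residual u \<in> L2 \<mu>"
  unfolding L2_proj_eq by (intro L2_diff lincomb_L2)

lemma residual_orthogonal:
  assumes u: "u \<in> L2 \<mu>"
  shows "(LINT x|\<mu>. residual u x * lincomb \<phi> c x) = 0"
proof -
  have "(LINT x|\<mu>. residual u x * \<phi> j x) = 0" for j
  proof -
    have "(LINT x|\<mu>. residual u x * \<phi> j x) = L2_inner \<mu> u (\<phi> j) - (LINT x|\<mu>. L2_proj \<mu> \<phi> u x * \<phi> j x)"
      unfolding L2_inner_def left_diff_distrib L2_proj_eq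
      by (intro Bochner_Integration.integral_diff L2_product_integrable u basis_L2 lincomb_L2)
    also have "(LINT x|\<mu>. L2_proj \<mu> \<phi> u x * \<phi> j x)
        = (\<Sum>k\<in>UNIV. L2_inner \<mu> u (\<phi> k) * (LINT x|\<mu>. \<phi> k x * \<phi> j x))"
      by (simp add: L2_proj_def sum_distrib_right mult.assoc Bochner_Integration.integral_sum
          L2_product_integrable basis_L2)
    finally show ?thesis by (simp add: basis_product_integral if_distrib cong: if_cong)
  qed
  moreover have "(LINT x|\<mu>. residual u x * lincomb \<phi> c x)
      = (\<Sum>j\<in>UNIV. c $ j * (LINT x|\<mu>. residual u x * \<phi> j x))"
  proof -
    have "residual u x * lincomb \<phi> c x = (\<Sum>j\<in>UNIV. c $ j * (residual u x * \<phi> j x))" for x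
      by (simp add: feature_inner sum_distrib_left mult_ac)
    then show ?thesis
      using L2_product_integrable[OF residual_L2[OF u] basis_L2]
      by (simp add: Bochner_Integration.integral_sum)
  qed
  ultimately show ?thesis by simp
qed

lemma L2_pythagoras:
  assumes u: "u \<in> L2 \<mu>"
  shows "(L2_norm \<mu> (\<lambda>t. u t - lincomb \<phi> c t))\<^sup>2
    = (L2_norm \<mu> (residual u))\<^sup>2 + (norm (c - proj_coeffs u))\<^sup>2"
proof -
  let ?d = "c - proj_coeffs u"
  have "(u t - lincomb \<phi> c t)\<^sup>2 = (residual u t)\<^sup>2 - 2 * (residual u t * lincomb \<phi> ?d t) + (lincomb \<phi> ?d t)\<^sup>2" for t
    by (simp add: L2_proj_eq inner_diff_right power2_eq_square algebra_simps)
  then show ?thesis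
    using residual_L2[OF u] L2_product_integrable[OF residual_L2[OF u] lincomb_L2, of ?d]
      residual_orthogonal[OF u, of ?d] feature_inner_square[of ?d]
    by (simp add: L2_norm_square L2_def)
qed

text \<open>The empirical projection contracts the empirical norm, and coercivity of the Gram matrix compares
  that norm with the true one on the span.\<close>

lemma ls_proj_error:
  assumes u: "u \<in> L2 \<mu>" and dev: "gram_dev \<phi> n x \<le> \<delta>" and \<delta>: "\<delta> < 1"
  shows "(L2_norm \<mu> (\<lambda>t. u t - ls_proj \<phi> n x u t))\<^sup>2
    \<le> (L2_norm \<mu> (residual u))\<^sup>2 + inverse (1 - \<delta>) * emp_inner \<phi> n x (residual u) (residual u)"
proof -
  let ?G = "emp_gram \<phi> n x" and ?g = "residual u"
  obtain c where c: "ls_proj \<phi> n x u = lincomb \<phi> c" "?G *v c = emp_moments \<phi> n x u"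
    using ls_proj_normal_equation[OF dev \<delta>] by blast
  define d where "d = c - proj_coeffs u"
  \<comment> \<open>The coefficients of the difference of the two projections solve the normal equations for the residual.\<close>
  have Gd: "?G *v d = emp_moments \<phi> n x ?g"
  proof -
    have "emp_moments \<phi> n x ?g = emp_moments \<phi> n x u - emp_moments \<phi> n x (L2_proj \<mu> \<phi> u)"
      by (simp add: emp_moments_def emp_inner_diff_left vec_eq_iff)
    then show ?thesis
      by (simp add: L2_proj_eq emp_moments_lincomb c(2)[symmetric] d_def matrix_vector_mult_diff_distrib)
  qed
  have "0 \<le> emp_inner \<phi> n x (\<lambda>t. ?g t - lincomb \<phi> d t) (\<lambda>t. ?g t - lincomb \<phi> d t)"
    by (rule emp_inner_nonneg)
  also have "\<dots> = emp_inner \<phi> n x ?g ?g - d \<bullet> (?G *v d)"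
    unfolding emp_inner_diff emp_inner_lincomb emp_moments_lincomb Gd[symmetric] by simp
  finally have "(1 - \<delta>) * (norm d)\<^sup>2 \<le> emp_inner \<phi> n x ?g ?g"
    using emp_gram_coercive[OF dev, of d] by linarith
  then have "(norm d)\<^sup>2 \<le> inverse (1 - \<delta>) * emp_inner \<phi> n x ?g ?g"
    using \<delta> by (simp add: field_simps)
  then show ?thesis
    unfolding c(1) L2_pythagoras[OF u] d_def[symmetric] by simp
qed

end

section \<open>The best of several samples\<close>

lemma best_indices_subset: "best_indices \<phi> n M \<omega> \<subseteq> {1..M}"
  by (auto simp: best_indices_def is_arg_min_def)

lemma best_indices_nonempty:
  assumes "1 \<le> M" shows "best_indices \<phi> n M \<omega> \<noteq> {}"
  using ex_is_arg_min_if_finite[of "{1..M}" "\<lambda>i. gram_dev \<phi> n (\<omega> i)"] assms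
  by (auto simp: best_indices_def)

lemma best_indices_eq:
  "best_indices \<phi> n M \<omega> = {i \<in> {1..M}. \<forall>j\<in>{1..M}. gram_dev \<phi> n (\<omega> i) \<le> gram_dev \<phi> n (\<omega> j)}"
  unfolding best_indices_def is_arg_min_def not_less[symmetric] by blast

lemma best_indices_minimal:
  "i \<in> best_indices \<phi> n M \<omega> \<Longrightarrow> j \<in> {1..M} \<Longrightarrow> gram_dev \<phi> n (\<omega> i) \<le> gram_dev \<phi> n (\<omega> j)"
  by (auto simp: best_indices_def is_arg_min_def not_less)

text \<open>Outside \<open>B\<close> the map \<open>\<omega>\<close> may leave the space of \<open>S\<close>. A version of it that is constant there is
  measurable and induces the same distribution, so that the rules for \<open>distr\<close> apply.\<close>

lemma distr_pmf_of_set: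
  assumes B: "finite B" "B \<noteq> {}" and \<omega>: "\<And>i. i \<in> B \<Longrightarrow> \<omega> i \<in> space S"
  shows "\<exists>\<omega>'. distr (measure_pmf (pmf_of_set B)) S \<omega> = distr (measure_pmf (pmf_of_set B)) S \<omega>'
    \<and> \<omega>' \<in> measurable (measure_pmf (pmf_of_set B)) S \<and> (\<forall>i\<in>B. \<omega>' i = \<omega> i)"
proof -
  let ?P = "measure_pmf (pmf_of_set B)"
  obtain b where b: "b \<in> B" using B by blast
  define \<omega>' where "\<omega>' i = (if i \<in> B then \<omega> i else \<omega> b)" for i
  have set: "set_pmf (pmf_of_set B) = B" using B by simp
  have "emeasure ?P (\<omega> -` A) = emeasure ?P (\<omega>' -` A)" for A
  proof -
    have "\<omega> -` A \<inter> B = \<omega>' -` A \<inter> B" by (auto simp: \<omega>'_def)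
    then show ?thesis
      using emeasure_Int_set_pmf[of "pmf_of_set B" "\<omega> -` A"] emeasure_Int_set_pmf[of "pmf_of_set B" "\<omega>' -` A"]
      by (simp add: set)
  qed
  then have "distr ?P S \<omega> = distr ?P S \<omega>'" by (simp add: distr_def)
  moreover have "\<omega>' \<in> measurable ?P S" using \<omega> b by (simp add: \<omega>'_def)
  moreover have "\<omega>' i = \<omega> i" if "i \<in> B" for i using that by (simp add: \<omega>'_def)
  ultimately show ?thesis by blast
qed

lemma emeasure_distr_pmf_of_set:
  assumes B: "finite B" "B \<noteq> {}" and \<omega>: "\<And>i. i \<in> B \<Longrightarrow> \<omega> i \<in> space S" and A: "A \<in> sets S"
  shows "emeasure (distr (measure_pmf (pmf_of_set B)) S \<omega>) A = (\<Sum>i\<in>B. indicator A (\<omega> i)) * ennreal (1 / card B)"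
proof -
  obtain \<omega>' where \<omega>': "distr (measure_pmf (pmf_of_set B)) S \<omega> = distr (measure_pmf (pmf_of_set B)) S \<omega>'"
    "\<omega>' \<in> measurable (measure_pmf (pmf_of_set B)) S" "\<And>i. i \<in> B \<Longrightarrow> \<omega>' i = \<omega> i"
    using distr_pmf_of_set[OF B, of \<omega> S] \<omega> by blast
  have "emeasure (distr (measure_pmf (pmf_of_set B)) S \<omega>) A
      = (\<integral>\<^sup>+i. indicator A (\<omega>' i) \<partial>measure_pmf (pmf_of_set B))"
    unfolding \<omega>'(1) using A \<omega>'(2)
    by (simp add: nn_integral_distr flip: nn_integral_indicator)
  also have "\<dots> = (\<Sum>i\<in>B. indicator A (\<omega>' i) * ennreal (1 / card B))"
    using B by (subst nn_integral_measure_pmf_finite) (auto simp: pmf_of_set intro!: sum.cong)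
  finally show ?thesis using \<omega>'(3) by (simp add: sum_distrib_right)
qed

lemma nn_integral_distr_pmf_of_set_le:
  assumes B: "finite B" "B \<noteq> {}" and \<omega>: "\<And>i. i \<in> B \<Longrightarrow> \<omega> i \<in> space S"
    and h: "h \<in> borel_measurable S" and le: "\<And>i. i \<in> B \<Longrightarrow> h (\<omega> i) \<le> c"
  shows "(\<integral>\<^sup>+y. h y \<partial>distr (measure_pmf (pmf_of_set B)) S \<omega>) \<le> c"
proof -
  obtain \<omega>' where \<omega>': "distr (measure_pmf (pmf_of_set B)) S \<omega> = distr (measure_pmf (pmf_of_set B)) S \<omega>'"
    "\<omega>' \<in> measurable (measure_pmf (pmf_of_set B)) S" "\<And>i. i \<in> B \<Longrightarrow> \<omega>' i = \<omega> i"
    using distr_pmf_of_set[OF B, of \<omega> S] \<omega> by blast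
  have "(\<integral>\<^sup>+y. h y \<partial>distr (measure_pmf (pmf_of_set B)) S \<omega>) = (\<integral>\<^sup>+i. h (\<omega>' i) \<partial>measure_pmf (pmf_of_set B))"
    unfolding \<omega>'(1) using h \<omega>'(2) by (simp add: nn_integral_distr)
  also have "\<dots> \<le> (\<integral>\<^sup>+i. c \<partial>measure_pmf (pmf_of_set B))"
    using B le \<omega>'(3) by (intro nn_integral_mono_AE) (simp add: AE_measure_pmf_iff)
  finally show ?thesis by simp
qed

context L2_orthonormal_system
begin

abbreviation "draws n M \<equiv> PiM {1..M} (\<lambda>_. sample_space n)"

abbreviation "selection n M \<omega> \<equiv>
  distr (measure_pmf (pmf_of_set (best_indices \<phi> n M \<omega>))) (sample_space n) (\<lambda>i. \<omega> i)"

lemma prob_space_draws: "prob_space (draws n M)"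
  by (intro prob_space_PiM prob_space_sample)

lemma draws_component: "\<omega> \<in> space (draws n M) \<Longrightarrow> i \<in> {1..M} \<Longrightarrow> \<omega> i \<in> space (sample_space n)"
  by (auto simp: space_PiM)

lemma draws_component_measurable:
  assumes h: "h \<in> borel_measurable (sample_space n)" and i: "i \<in> {1..M}"
  shows "(\<lambda>\<omega>. h (\<omega> i)) \<in> borel_measurable (draws n M)"
  by (rule measurable_compose[OF measurable_component_singleton[OF i] h])

lemma best_indices_measurable:
  "best_indices \<phi> n M \<in> measurable (draws n M) (count_space (Pow {1..M}))"
proof (subst measurable_count_space_eq2, simp, intro conjI ballI)
  show "best_indices \<phi> n M \<in> space (draws n M) \<rightarrow> Pow {1..M}"
    using best_indices_subset[of \<phi> n M] by blast
  fix B assume B: "B \<in> Pow {1..M}"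
  have "best_indices \<phi> n M -` {B} \<inter> space (draws n M) = {\<omega> \<in> space (draws n M).
      \<forall>i\<in>{1..M}. i \<in> B \<longleftrightarrow> (\<forall>j\<in>{1..M}. gram_dev \<phi> n (\<omega> i) \<le> gram_dev \<phi> n (\<omega> j))}"
  proof -
    have "best_indices \<phi> n M \<omega> = B
        \<longleftrightarrow> (\<forall>i\<in>{1..M}. i \<in> B \<longleftrightarrow> (\<forall>j\<in>{1..M}. gram_dev \<phi> n (\<omega> i) \<le> gram_dev \<phi> n (\<omega> j)))" for \<omega>
      unfolding best_indices_eq using B by blast
    then show ?thesis by blast
  qed
  moreover have "\<dots> \<in> sets (draws n M)"
  proof -
    have le: "Measurable.pred (draws n M) (\<lambda>\<omega>. gram_dev \<phi> n (\<omega> i) \<le> gram_dev \<phi> n (\<omega> j))"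
      if "i \<in> {1..M}" "j \<in> {1..M}" for i j
      unfolding pred_def
      by (intro borel_measurable_le draws_component_measurable[OF gram_dev_measurable] that)
    show ?thesis by measurable (rule le)
  qed
  ultimately show "best_indices \<phi> n M -` {B} \<inter> space (draws n M) \<in> sets (draws n M)" by simp
qed

text \<open>The set of best indices takes finitely many values, each on a measurable event, and for a fixed
  index set the kernel is a finite average of point masses. Measurability of the kernel makes the
  \<open>bind\<close> in the law of the best sample meaningful.\<close>

lemma selection_measurable:
  assumes M: "1 \<le> M"
  shows "selection n M \<in> measurable (draws n M) (subprob_algebra (sample_space n))"
proof -
  let ?I = "Pow {1..M} - {{}}" and ?S = "sample_space n"
  have I: "finite B" "B \<noteq> {}" "B \<subseteq> {1..M}" if "B \<in> ?I" for B
    using that finite_subset[of B "{1..M}"] by auto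
  have "(\<lambda>\<omega>. distr (measure_pmf (pmf_of_set B)) ?S (\<lambda>i. \<omega> i)) \<in> measurable (draws n M) (subprob_algebra ?S)"
    if B: "B \<in> ?I" for B
  proof (rule measurable_subprob_algebra)
    fix \<omega> assume \<omega>: "\<omega> \<in> space (draws n M)"
    then have \<omega>B: "\<omega> i \<in> space ?S" if "i \<in> B" for i using I(3)[OF B] that draws_component by blast
    obtain \<omega>' where \<omega>': "distr (measure_pmf (pmf_of_set B)) ?S \<omega> = distr (measure_pmf (pmf_of_set B)) ?S \<omega>'"
      "\<omega>' \<in> measurable (measure_pmf (pmf_of_set B)) ?S"
      using distr_pmf_of_set[OF I(1,2)[OF B], of \<omega> ?S] \<omega>B by blast
    show "subprob_space (distr (measure_pmf (pmf_of_set B)) ?S (\<lambda>i. \<omega> i))"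
      unfolding \<omega>'(1) using measure_pmf.prob_space_distr[OF \<omega>'(2)]
      by (rule prob_space_imp_subprob_space)
  next
    fix A assume A: "A \<in> sets ?S"
    have "(\<lambda>\<omega>. (\<Sum>i\<in>B. indicator A (\<omega> i)) * ennreal (1 / card B)) \<in> borel_measurable (draws n M)"
      using I(3)[OF B] A
      by (intro borel_measurable_times_ennreal borel_measurable_const borel_measurable_sum
          draws_component_measurable[of "indicator A"]) auto
    then show "(\<lambda>\<omega>. emeasure (distr (measure_pmf (pmf_of_set B)) ?S (\<lambda>i. \<omega> i)) A) \<in> borel_measurable (draws n M)"
    proof (rule measurable_cong[THEN iffD1, rotated])
      fix \<omega> assume "\<omega> \<in> space (draws n M)"
      then have "\<omega> i \<in> space ?S" if "i \<in> B" for i using I(3)[OF B] that draws_component by blast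
      from emeasure_distr_pmf_of_set[OF I(1,2)[OF B] this A]
      show "(\<Sum>i\<in>B. indicator A (\<omega> i)) * ennreal (1 / card B)
        = emeasure (distr (measure_pmf (pmf_of_set B)) ?S (\<lambda>i. \<omega> i)) A" by simp
    qed
  qed simp
  moreover have "best_indices \<phi> n M \<in> measurable (draws n M) (count_space ?I)"
  proof (rule measurable_count_space_eq2[THEN iffD2])
    have "best_indices \<phi> n M -` {B} \<inter> space (draws n M) \<in> sets (draws n M)" if "B \<in> ?I" for B
      using measurable_sets[OF best_indices_measurable, of "{B}"] that by simp
    moreover have "best_indices \<phi> n M \<in> space (draws n M) \<rightarrow> ?I"
      using best_indices_subset[of \<phi> n M] best_indices_nonempty[OF M, of \<phi> n] by blast
    ultimately show "best_indices \<phi> n M \<in> space (draws n M) \<rightarrow> ?I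
      \<and> (\<forall>B\<in>?I. best_indices \<phi> n M -` {B} \<inter> space (draws n M) \<in> sets (draws n M))"
      by blast
  qed simp
  ultimately show ?thesis
    by (rule measurable_compose_countable'[where f = "\<lambda>B \<omega>. distr (measure_pmf (pmf_of_set B)) ?S (\<lambda>i. \<omega> i)"])
      (assumption, intro countable_finite finite_Diff, simp)
qed

lemma sets_best_sample:
  assumes "1 \<le> M" shows "sets (best_sample_measure \<mu> \<phi> n M) = sets (sample_space n)"
  unfolding best_sample_measure_def
  using prob_space.not_empty[OF prob_space_draws] by (intro sets_bind) auto

text \<open>The way in which selection enters all later estimates: any bound \<open>H\<close> that holds for every
  minimiser survives the random choice among ties.\<close>

lemma nn_integral_best_sample_le:
  assumes M: "1 \<le> M" and h: "h \<in> borel_measurable (sample_space n)"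
    and le: "\<And>\<omega> i. \<omega> \<in> space (draws n M) \<Longrightarrow> i \<in> best_indices \<phi> n M \<omega> \<Longrightarrow> h (\<omega> i) \<le> H \<omega>"
  shows "(\<integral>\<^sup>+x. h x \<partial>best_sample_measure \<mu> \<phi> n M) \<le> (\<integral>\<^sup>+\<omega>. H \<omega> \<partial>draws n M)"
  unfolding best_sample_measure_def nn_integral_bind[OF h selection_measurable[OF M]]
proof (rule nn_integral_mono)
  fix \<omega> assume \<omega>: "\<omega> \<in> space (draws n M)"
  show "(\<integral>\<^sup>+x. h x \<partial>selection n M \<omega>) \<le> H \<omega>"
    using best_indices_subset[of \<phi> n M \<omega>] best_indices_nonempty[OF M] le[OF \<omega>] draws_component[OF \<omega>]
    by (intro nn_integral_distr_pmf_of_set_le h) (auto intro: finite_subset)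
qed

lemma prob_space_best_sample:
  assumes M: "1 \<le> M" shows "prob_space (best_sample_measure \<mu> \<phi> n M)"
proof (rule prob_spaceI)
  let ?N = "best_sample_measure \<mu> \<phi> n M" and ?S = "sample_space n"
  interpret \<Omega>: prob_space "draws n M" by (rule prob_space_draws)
  have sp: "space ?N = space ?S" using sets_best_sample[OF M] by (rule sets_eq_imp_space_eq)
  have "emeasure ?N (space ?S) = (\<integral>\<^sup>+\<omega>. emeasure (selection n M \<omega>) (space ?S) \<partial>draws n M)"
    unfolding best_sample_measure_def
    by (rule emeasure_bind[OF \<Omega>.not_empty selection_measurable[OF M] sets.top])
  also have "\<dots> = (\<integral>\<^sup>+\<omega>. 1 \<partial>draws n M)"
  proof (rule nn_integral_cong)
    fix \<omega> assume \<omega>: "\<omega> \<in> space (draws n M)"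
    let ?B = "best_indices \<phi> n M \<omega>"
    have B: "finite ?B" "?B \<noteq> {}" "\<And>i. i \<in> ?B \<Longrightarrow> \<omega> i \<in> space ?S"
      using best_indices_subset[of \<phi> n M \<omega>] best_indices_nonempty[OF M] draws_component[OF \<omega>]
      by (auto intro: finite_subset)
    have "(\<Sum>i\<in>?B. indicator (space ?S) (\<omega> i)) = (\<Sum>i\<in>?B. 1::ennreal)"
      using B(3) by (intro sum.cong) auto
    then show "emeasure (selection n M \<omega>) (space ?S) = 1"
      using B by (subst emeasure_distr_pmf_of_set)
        (auto simp: ennreal_of_nat_eq_real_of_nat ennreal_mult[symmetric])
  qed
  also have "\<dots> = 1" by (simp only: nn_integral_const mult_1 \<Omega>.emeasure_space_1)
  finally show "emeasure ?N (space ?N) = 1" by (simp only: sp)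
qed

text \<open>The best sample is unstable only if all \<open>M\<close> independent samples are.\<close>

lemma best_sample_unstable_probability:
  assumes M: "1 \<le> M"
  shows "emeasure (best_sample_measure \<mu> \<phi> n M) {x \<in> space (sample_space n). \<delta> < gram_dev \<phi> n x}
    \<le> (emeasure (sample_space n) {x \<in> space (sample_space n). \<delta> < gram_dev \<phi> n x}) ^ M"
proof -
  let ?S = "sample_space n" and ?N = "best_sample_measure \<mu> \<phi> n M"
  let ?U = "{x \<in> space ?S. \<delta> < gram_dev \<phi> n x}"
  interpret S: prob_space ?S by (rule prob_space_sample)
  interpret P: product_sigma_finite "\<lambda>_. ?S" ..
  have U: "?U \<in> sets ?S" by measurable
  have "emeasure ?N ?U = (\<integral>\<^sup>+x. indicator ?U x \<partial>?N)"
    using U sets_best_sample[OF M] by simp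
  also have "\<dots> \<le> (\<integral>\<^sup>+\<omega>. indicator (PiE {1..M} (\<lambda>_. ?U)) \<omega> \<partial>draws n M)"
  proof (rule nn_integral_best_sample_le[OF M])
    fix \<omega> i assume \<omega>: "\<omega> \<in> space (draws n M)" and i: "i \<in> best_indices \<phi> n M \<omega>"
    have "\<omega> \<in> PiE {1..M} (\<lambda>_. ?U)" if "\<omega> i \<in> ?U"
    proof (rule PiE_I)
      fix j assume j: "j \<in> {1..M}"
      have "\<delta> < gram_dev \<phi> n (\<omega> j)" using that best_indices_minimal[OF i j] by simp
      then show "\<omega> j \<in> ?U" using draws_component[OF \<omega> j] by simp
    next
      fix j assume "j \<notin> {1..M}"
      then show "\<omega> j = undefined" using \<omega> unfolding space_PiM by (rule PiE_arb[rotated])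
    qed
    then show "(indicator ?U (\<omega> i) :: ennreal) \<le> indicator (PiE {1..M} (\<lambda>_. ?U)) \<omega>"
      by (auto split: split_indicator)
  qed (use U in simp)
  also have "\<dots> = emeasure (draws n M) (PiE {1..M} (\<lambda>_. ?U))"
    using U by (intro nn_integral_indicator sets_PiM_I_finite) auto
  also have "\<dots> = (emeasure ?S ?U) ^ M"
    using U by (subst P.emeasure_PiM) auto
  finally show ?thesis .
qed

abbreviation "stable_event n \<delta> \<equiv> {x \<in> space (sample_space n). gram_dev \<phi> n x \<le> \<delta>}"

lemma best_sample_stable_probability:
  assumes M: "1 \<le> M" and \<eta>: "0 \<le> \<eta>"
    and U: "emeasure (sample_space n) {x \<in> space (sample_space n). \<delta> < gram_dev \<phi> n x} \<le> ennreal \<eta>"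
  shows "ennreal (1 - \<eta> ^ M) \<le> emeasure (best_sample_measure \<mu> \<phi> n M) (stable_event n \<delta>)"
proof -
  let ?S = "sample_space n" and ?N = "best_sample_measure \<mu> \<phi> n M"
  let ?U = "{x \<in> space ?S. \<delta> < gram_dev \<phi> n x}"
  interpret N: prob_space ?N by (rule prob_space_best_sample[OF M])
  have sets: "sets ?N = sets ?S" and sp: "space ?N = space ?S"
    using sets_best_sample[OF M, of n] sets_eq_imp_space_eq[OF sets_best_sample[OF M, of n]] by auto
  have A: "stable_event n \<delta> \<in> sets ?N" unfolding sets by measurable
  have "emeasure ?N ?U \<le> ennreal (\<eta> ^ M)"
    using order_trans[OF best_sample_unstable_probability[OF M] power_mono[OF U]] \<eta>
    by (simp add: ennreal_power)
  moreover have "?U = space ?N - stable_event n \<delta>" by (auto simp: sp)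
  ultimately have "1 - N.prob (stable_event n \<delta>) \<le> \<eta> ^ M"
    using \<eta> by (simp add: N.emeasure_eq_measure N.prob_compl[OF A])
  then show ?thesis by (simp add: N.emeasure_eq_measure)
qed

text \<open>Conditioning on an event of probability at least \<open>p\<close> increases expectations of nonnegative
  functions by a factor of at most \<open>1 / p\<close>. The integrand \<open>F\<close> enters only through a measurable
  majorant on the stable event, because the least-squares projection makes an arbitrary choice on
  unstable samples.\<close>

lemma stable_expectation_le:
  fixes F :: "(nat \<Rightarrow> 'a) \<Rightarrow> real"
  assumes M: "1 \<le> M" and p: "0 < p" "ennreal p \<le> emeasure (best_sample_measure \<mu> \<phi> n M) (stable_event n \<delta>)"
    and Y: "Y \<in> borel_measurable (sample_space n)" "\<And>x. 0 \<le> Y x"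
    and k: "0 \<le> k" and a: "0 \<le> a"
    and le: "\<And>x. gram_dev \<phi> n x \<le> \<delta> \<Longrightarrow> F x \<le> a + k * Y x"
    and E: "(\<integral>\<^sup>+x. ennreal (Y x) \<partial>best_sample_measure \<mu> \<phi> n M) \<le> ennreal e" and e: "0 \<le> e"
  shows "(\<integral>\<^sup>+x. ennreal (F x) \<partial>stable_sample_measure \<mu> \<phi> n M \<delta>) \<le> ennreal (a + k * inverse p * e)"
proof -
  let ?S = "sample_space n" and ?N = "best_sample_measure \<mu> \<phi> n M"
  let ?A = "stable_event n \<delta>" and ?Q = "stable_sample_measure \<mu> \<phi> n M \<delta>"
  interpret N: prob_space ?N by (rule prob_space_best_sample[OF M])
  note sets = sets_best_sample[OF M, of n]
  have A: "?A \<in> sets ?N" unfolding sets by measurable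
  have YN: "Y \<in> borel_measurable ?N" using Y by (simp add: measurable_cong_sets[OF sets refl])
  have YQ: "Y \<in> borel_measurable ?Q" using YN by (simp add: stable_sample_measure_def)
  have prob: "p \<le> N.prob ?A" using p by (simp add: N.emeasure_eq_measure)
  have pos: "emeasure ?N ?A \<noteq> 0" using p by (metis ennreal_eq_0_iff le_zero_eq not_le)
  have Q: "prob_space ?Q" unfolding stable_sample_measure_def
    by (rule prob_space_uniform_measure) (use pos in auto)
  have "(\<integral>\<^sup>+x. ennreal (Y x) \<partial>?Q) = (\<integral>\<^sup>+x. ennreal (Y x) * indicator ?A x \<partial>?N) / emeasure ?N ?A"
    unfolding stable_sample_measure_def using YN A by (intro nn_integral_uniform_measure) auto
  also have "\<dots> \<le> ennreal e / ennreal p"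
  proof -
    have "(\<integral>\<^sup>+x. ennreal (Y x) * indicator ?A x \<partial>?N) \<le> (\<integral>\<^sup>+x. ennreal (Y x) \<partial>?N)"
      by (intro nn_integral_mono) (auto split: split_indicator)
    then have "(\<integral>\<^sup>+x. ennreal (Y x) * indicator ?A x \<partial>?N) \<le> ennreal e" using E by (rule order_trans)
    then have "(\<integral>\<^sup>+x. ennreal (Y x) * indicator ?A x \<partial>?N) / emeasure ?N ?A \<le> ennreal e / emeasure ?N ?A"
      by (rule divide_right_mono_ennreal)
    also have "\<dots> = ennreal (e / N.prob ?A)"
      using prob e p(1) by (simp add: N.emeasure_eq_measure divide_ennreal)
    also have "\<dots> \<le> ennreal (e / p)"
      using prob e p(1) by (intro ennreal_leI divide_left_mono) auto
    also have "\<dots> = ennreal e / ennreal p" using e p(1) by (simp add: divide_ennreal)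
    finally show ?thesis .
  qed
  also have "\<dots> = ennreal (inverse p * e)"
    using p e by (simp add: divide_ennreal divide_inverse mult.commute)
  finally have EY: "(\<integral>\<^sup>+x. ennreal (Y x) \<partial>?Q) \<le> ennreal (inverse p * e)" .
  have "(\<integral>\<^sup>+x. ennreal (F x) \<partial>?Q) \<le> (\<integral>\<^sup>+x. ennreal a + ennreal k * ennreal (Y x) \<partial>?Q)"
  proof (rule nn_integral_mono_AE)
    show "AE x in ?Q. ennreal (F x) \<le> ennreal a + ennreal k * ennreal (Y x)"
      unfolding stable_sample_measure_def
    proof (rule AE_uniform_measureI[OF A], rule AE_I2, rule impI)
      fix x assume "x \<in> ?A"
      then have "F x \<le> a + k * Y x" using le by simp
      then show "ennreal (F x) \<le> ennreal a + ennreal k * ennreal (Y x)"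
        using a k Y(2)[of x] by (simp add: ennreal_mult[symmetric] ennreal_plus[symmetric] ennreal_leI del: ennreal_plus)
    qed
  qed
  also have "\<dots> = ennreal a + ennreal k * (\<integral>\<^sup>+x. ennreal (Y x) \<partial>?Q)"
    using YQ by (subst nn_integral_add) (auto simp: nn_integral_cmult prob_space.emeasure_space_1[OF Q])
  also have "\<dots> \<le> ennreal a + ennreal k * ennreal (inverse p * e)"
    by (intro add_left_mono mult_left_mono EY) simp
  also have "\<dots> = ennreal (a + k * inverse p * e)"
    using a k p e by (simp add: ennreal_mult[symmetric] ennreal_plus[symmetric] mult.assoc del: ennreal_plus)
  finally show ?thesis .
qed

end

section \<open>Expectation of the empirical residual under the best sample\<close>

lemma bounded_le_one_minus_prod:
  fixes y :: "'i \<Rightarrow> real"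
  assumes "finite I" "i \<in> I" "\<And>j. j \<in> I \<Longrightarrow> 0 \<le> y j \<and> y j \<le> 1"
  shows "y i \<le> 1 - (\<Prod>j\<in>I. 1 - y j)"
proof -
  have "(\<Prod>j\<in>I. 1 - y j) = (1 - y i) * (\<Prod>j\<in>I - {i}. 1 - y j)"
    using assms by (intro prod.remove) auto
  also have "\<dots> \<le> (1 - y i) * 1"
    using assms by (intro mult_left_mono prod_le_1) auto
  finally show ?thesis by simp
qed

text \<open>The left-hand side is the integral over \<open>[0, a]\<close> of the density \<open>M (1 - u)^(M - 1)\<close> of the
  minimum of \<open>M\<close> uniform variables, and \<open>C_const \<epsilon> M\<close> is the norm of this density in
  \<open>L^(1 / (1 - \<epsilon>))\<close>: the inequality is Hoelder's. It is proved by integrating Young's inequality with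
  weights \<open>k\<close> and \<open>k'\<close>, chosen so that the integrals of its two terms are at most \<open>1 - \<epsilon>\<close> and \<open>\<epsilon>\<close> times
  the bound (divided by \<open>M\<close>).\<close>

lemma one_minus_power_le_C_const:
  fixes a \<epsilon> :: real
  assumes a: "0 \<le> a" "a \<le> 1" and \<epsilon>: "0 < \<epsilon>" "\<epsilon> \<le> 1" and M: "1 \<le> M"
  shows "1 - (1 - a) ^ M \<le> C_const \<epsilon> M * rpow a \<epsilon>"
proof -
  consider "\<epsilon> = 1" | "\<epsilon> < 1" "a = 0" | "\<epsilon> < 1" "0 < a" using \<epsilon> a by linarith
  then show ?thesis
  proof cases
    case 1
    have "1 + real M * (- a) \<le> (1 + - a) ^ M" using a by (intro Bernoulli_inequality) auto
    then show ?thesis using 1 a by (simp add: C_const_1 rpow_def)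
  next
    case 2
    then show ?thesis using \<epsilon> by (simp add: rpow_def)
  next
    case 3
    define r where "r = (real M - \<epsilon>) / (1 - \<epsilon>)"
    define k where "k = (a * r) powr \<epsilon>"
    define k' where "k' = (a * r) powr (\<epsilon> - 1)"
    have r: "1 \<le> r" using 3 M by (simp add: r_def field_simps)
    have kpos: "0 < k" "0 < k'" using 3 r by (auto simp: k_def k'_def)
    have C: "C_const \<epsilon> M = real M * r powr (\<epsilon> - 1)"
    proof -
      have "r powr (1 - \<epsilon>) = (real M - \<epsilon>) powr (1 - \<epsilon>) / (1 - \<epsilon>) powr (1 - \<epsilon>)"
        unfolding r_def by (rule powr_divide)
      moreover have "r powr (\<epsilon> - 1) = inverse (r powr (1 - \<epsilon>))"
        by (simp add: powr_minus[symmetric])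
      ultimately show ?thesis using 3 by (simp add: C_const_def rpow_def)
    qed
    define \<psi> where "\<psi> u = (1 - (1 - u) ^ M) / real M
        - (1 - \<epsilon>) * k / r * (1 - (1 - u) powr r) - \<epsilon> * k' * u" for u :: real
    have "\<psi> a \<le> \<psi> 0"
    proof (rule DERIV_nonpos_imp_decreasing_open[of 0 a \<psi>])
      show "continuous_on {0..a} \<psi>"
      proof -
        have "continuous_on {0..a} (\<lambda>u. (1 - u) powr r)"
          using r a by (intro continuous_on_powr' continuous_on_diff continuous_on_const continuous_on_id) auto
        moreover have "real M \<noteq> 0" using M by simp
        ultimately show ?thesis
          unfolding \<psi>_def
          by (intro continuous_on_diff continuous_on_mult continuous_on_divide continuous_on_power
              continuous_on_const continuous_on_id) simp_all
      qed
      fix u assume u: "0 < u" "u < a"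
      have u1: "0 < 1 - u" using u a by simp
      let ?D = "(1 - u) ^ (M - 1) - (1 - \<epsilon>) * k * (1 - u) powr (r - 1) - \<epsilon> * k'"
      have "(\<psi> has_real_derivative
          (- (real M * (1 - u) ^ (M - 1) * (- 1))) / real M
          - (1 - \<epsilon>) * k / r * (- (r * (1 - u) powr (r - 1) * (- 1))) - \<epsilon> * k') (at u)"
        unfolding \<psi>_def using u1 by (auto intro!: derivative_eq_intros)
      moreover have "(- (real M * (1 - u) ^ (M - 1) * (- 1))) / real M
          - (1 - \<epsilon>) * k / r * (- (r * (1 - u) powr (r - 1) * (- 1))) - \<epsilon> * k' = ?D"
        using M r by simp
      moreover have "?D \<le> 0"
      proof -
        have "k powr (1 - \<epsilon>) * k' powr \<epsilon> = 1"
          using 3 r by (simp add: k_def k'_def powr_powr powr_add[symmetric] algebra_simps)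
        moreover have "((1 - u) powr (r - 1)) powr (1 - \<epsilon>) = (1 - u) ^ (M - 1)"
        proof -
          have "(r - 1) * (1 - \<epsilon>) = real (M - 1)" using 3 M by (simp add: r_def field_simps)
          then show ?thesis using u1 by (simp add: powr_powr powr_realpow)
        qed
        ultimately have "(1 - u) ^ (M - 1) = (k * (1 - u) powr (r - 1)) powr (1 - \<epsilon>) * k' powr \<epsilon>"
          using kpos u1 by (simp add: powr_mult)
        also have "\<dots> \<le> (1 - \<epsilon>) * (k * (1 - u) powr (r - 1)) + \<epsilon> * k'"
          using kpos u1 3 \<epsilon> by (intro Youngs_inequality_0) auto
        finally show ?thesis by simp
      qed
      ultimately show "\<exists>y. (\<psi> has_real_derivative y) (at u) \<and> y \<le> 0" by metis
    qed (use a in simp)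
    moreover have "\<psi> 0 = 0" by (simp add: \<psi>_def)
    ultimately have "(1 - (1 - a) ^ M) / real M \<le> (1 - \<epsilon>) * (k / r) * (1 - (1 - a) powr r) + \<epsilon> * (k' * a)"
      by (simp add: \<psi>_def)
    also have "\<dots> \<le> (1 - \<epsilon>) * (k / r) * 1 + \<epsilon> * (k' * a)"
      using 3 kpos r by (intro add_right_mono mult_left_mono) auto
    also have "k / r = a powr \<epsilon> * r powr (\<epsilon> - 1)"
      using 3 r by (simp add: k_def powr_mult powr_diff)
    also have "k' * a = a powr \<epsilon> * r powr (\<epsilon> - 1)"
      using 3 r by (simp add: k'_def powr_mult powr_diff)
    finally have "(1 - (1 - a) ^ M) / real M \<le> a powr \<epsilon> * r powr (\<epsilon> - 1)"
      by (simp add: algebra_simps)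
    then show ?thesis using M \<epsilon> by (simp add: C rpow_def field_simps)
  qed
qed

lemma C_const_nonneg: "0 < \<epsilon> \<Longrightarrow> \<epsilon> \<le> 1 \<Longrightarrow> 0 \<le> C_const \<epsilon> M"
  by (simp add: C_const_def rpow_def)

lemma rpow_nonneg: "0 \<le> rpow x a"
  by (simp add: rpow_def)

context L2_orthonormal_system
begin

lemma draws_component_expectation:
  assumes h: "h \<in> borel_measurable (sample_space n)" and i: "i \<in> {1..M}"
  shows "(\<integral>\<^sup>+\<omega>. h (\<omega> i) \<partial>draws n M) = (\<integral>\<^sup>+x. h x \<partial>sample_space n)"
proof -
  have "(\<integral>\<^sup>+x. h x \<partial>sample_space n) = (\<integral>\<^sup>+x. h x \<partial>distr (draws n M) (sample_space n) (\<lambda>\<omega>. \<omega> i))"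
    by (subst distr_PiM_component[OF prob_space_sample i]) (rule refl)
  also have "\<dots> = (\<integral>\<^sup>+\<omega>. h (\<omega> i) \<partial>draws n M)"
    using h by (intro nn_integral_distr measurable_component_singleton i) simp
  finally show ?thesis by simp
qed

lemma sample_component_expectation:
  assumes h: "h \<in> borel_measurable \<mu>" and i: "i \<in> {1..n}"
  shows "(\<integral>\<^sup>+x. h (x i) \<partial>sample_space n) = (\<integral>\<^sup>+y. h y \<partial>\<rho>)"
proof -
  have "(\<integral>\<^sup>+y. h y \<partial>\<rho>) = (\<integral>\<^sup>+y. h y \<partial>distr (sample_space n) \<rho> (\<lambda>x. x i))"
    unfolding sample_measure_def by (subst distr_PiM_component[OF prob_space_sampling i]) (rule refl)
  also have "\<dots> = (\<integral>\<^sup>+x. h (x i) \<partial>sample_space n)"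
    unfolding sample_measure_def
    using h by (intro nn_integral_distr measurable_component_singleton i) simp
  finally show ?thesis by simp
qed

lemma emp_inner_measurable:
  assumes g: "g \<in> borel_measurable \<mu>"
  shows "(\<lambda>x. emp_inner \<phi> n x g g) \<in> borel_measurable (sample_space n)"
  unfolding emp_inner_def
  by (intro borel_measurable_divide borel_measurable_sum borel_measurable_times borel_measurable_const
      sample_eval_measurable[OF weight_measurable] sample_eval_measurable[OF g])

lemma emp_inner_expectation:
  assumes g: "g \<in> L2 \<mu>" and n: "0 < n"
  shows "(\<integral>\<^sup>+x. ennreal (emp_inner \<phi> n x g g) \<partial>sample_space n) \<le> ennreal ((L2_norm \<mu> g)\<^sup>2)"
proof -
  let ?h = "\<lambda>y. weight \<phi> y * (g y)\<^sup>2"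
  have gm[measurable]: "g \<in> borel_measurable \<mu>" using g by (simp add: L2_def)
  have hm: "(\<lambda>y. ennreal (?h y)) \<in> borel_measurable \<mu>" by measurable
  have "ennreal (emp_inner \<phi> n x g g) = ennreal (1 / real n) * (\<Sum>i=1..n. ennreal (?h (x i)))" for x
  proof -
    have "emp_inner \<phi> n x g g = 1 / real n * (\<Sum>i=1..n. ?h (x i))"
      by (simp add: emp_inner_def power2_eq_square mult.assoc)
    moreover have "ennreal (1 / real n * (\<Sum>i=1..n. ?h (x i))) = ennreal (1 / real n) * ennreal (\<Sum>i=1..n. ?h (x i))"
      by (intro ennreal_mult sum_nonneg mult_nonneg_nonneg weight_nonneg) auto
    moreover have "ennreal (\<Sum>i=1..n. ?h (x i)) = (\<Sum>i=1..n. ennreal (?h (x i)))"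
      by (intro sum_ennreal[symmetric] mult_nonneg_nonneg weight_nonneg) auto
    ultimately show ?thesis by simp
  qed
  then have "(\<integral>\<^sup>+x. ennreal (emp_inner \<phi> n x g g) \<partial>sample_space n)
      = (\<integral>\<^sup>+x. ennreal (1 / real n) * (\<Sum>i=1..n. ennreal (?h (x i))) \<partial>sample_space n)" by simp
  also have "\<dots> = ennreal (1 / real n) * (\<Sum>i=1..n. \<integral>\<^sup>+x. ennreal (?h (x i)) \<partial>sample_space n)"
  proof -
    have m: "(\<lambda>x. ennreal (?h (x i))) \<in> borel_measurable (sample_space n)" if "i \<in> {1..n}" for i
      by (rule measurable_compose[OF sample_component_measurable[OF that] hm])
    show ?thesis
      by (subst nn_integral_cmult[OF borel_measurable_sum[OF m]], assumption,
          subst nn_integral_sum[OF m]) simp_all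
  qed
  also have "\<dots> = ennreal (1 / real n) * (\<Sum>i=1..n. \<integral>\<^sup>+y. ennreal (?h y) \<partial>\<rho>)"
    by (intro arg_cong[where f = "(*) (ennreal (1 / real n))"] sum.cong refl sample_component_expectation[OF hm])
  also have "\<dots> = (ennreal (1 / real n) * of_nat n) * (\<integral>\<^sup>+y. ennreal (?h y) \<partial>\<rho>)"
    by (simp add: mult.assoc)
  also have "ennreal (1 / real n) * of_nat n = 1"
    using n by (simp add: ennreal_of_nat_eq_real_of_nat ennreal_mult[symmetric])
  also have "1 * (\<integral>\<^sup>+y. ennreal (?h y) \<partial>\<rho>) \<le> (\<integral>\<^sup>+y. ennreal ((g y)\<^sup>2) \<partial>\<mu>)"
    by (simp add: weighted_square_expectation)
  also have "\<dots> = ennreal ((L2_norm \<mu> g)\<^sup>2)"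
    using g unfolding L2_norm_square by (intro nn_integral_eq_integral) (auto simp: L2_def)
  finally show ?thesis .
qed

lemma best_sample_expectation_le_sum:
  assumes M: "1 \<le> M" and Y: "Y \<in> borel_measurable (sample_space n)"
  shows "(\<integral>\<^sup>+x. Y x \<partial>best_sample_measure \<mu> \<phi> n M) \<le> of_nat M * (\<integral>\<^sup>+x. Y x \<partial>sample_space n)"
proof -
  have "(\<integral>\<^sup>+x. Y x \<partial>best_sample_measure \<mu> \<phi> n M) \<le> (\<integral>\<^sup>+\<omega>. (\<Sum>i=1..M. Y (\<omega> i)) \<partial>draws n M)"
  proof (rule nn_integral_best_sample_le[OF M Y])
    fix \<omega> i assume "i \<in> best_indices \<phi> n M \<omega>"
    then show "Y (\<omega> i) \<le> (\<Sum>i=1..M. Y (\<omega> i))"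
      using best_indices_subset[of \<phi> n M \<omega>] by (intro member_le_sum) auto
  qed
  also have "\<dots> = (\<Sum>i=1..M. \<integral>\<^sup>+\<omega>. Y (\<omega> i) \<partial>draws n M)"
    by (intro nn_integral_sum draws_component_measurable Y)
  also have "\<dots> = (\<Sum>i=1..M. \<integral>\<^sup>+x. Y x \<partial>sample_space n)"
    by (intro sum.cong refl draws_component_expectation Y)
  finally show ?thesis by simp
qed

text \<open>A function with values in \<open>[0, 1]\<close> is dominated at the selected sample by one minus the
  product of the complements over all samples, whose expectation factorises by independence.\<close>

lemma best_sample_expectation_le_one_minus_power:
  assumes M: "1 \<le> M" and Y: "Y \<in> borel_measurable (sample_space n)"
    and Y01: "\<And>x. x \<in> space (sample_space n) \<Longrightarrow> 0 \<le> Y x \<and> Y x \<le> 1"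
  shows "(\<integral>\<^sup>+x. ennreal (Y x) \<partial>best_sample_measure \<mu> \<phi> n M)
    \<le> ennreal (1 - (1 - (LINT x|sample_space n. Y x)) ^ M)"
proof -
  let ?S = "sample_space n"
  interpret S: prob_space ?S by (rule prob_space_sample)
  interpret \<Omega>: prob_space "draws n M" by (rule prob_space_draws)
  interpret P: product_sigma_finite "\<lambda>_. ?S" ..
  have Yi: "integrable ?S Y"
    using Y Y01 by (intro S.integrable_const_bound[of _ 1]) auto
  then have Zi: "integrable ?S (\<lambda>x. 1 - Y x)" by simp
  have prod_int: "integrable (draws n M) (\<lambda>\<omega>. \<Prod>j\<in>{1..M}. 1 - Y (\<omega> j))"
    by (intro P.product_integrable_prod Zi) simp
  let ?H = "\<lambda>\<omega>. 1 - (\<Prod>j\<in>{1..M}. 1 - Y (\<omega> j))"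
  have "(\<integral>\<^sup>+x. ennreal (Y x) \<partial>best_sample_measure \<mu> \<phi> n M) \<le> (\<integral>\<^sup>+\<omega>. ennreal (?H \<omega>) \<partial>draws n M)"
  proof (rule nn_integral_best_sample_le[OF M])
    fix \<omega> i assume \<omega>: "\<omega> \<in> space (draws n M)" and i: "i \<in> best_indices \<phi> n M \<omega>"
    then show "ennreal (Y (\<omega> i)) \<le> ennreal (?H \<omega>)"
      using best_indices_subset[of \<phi> n M \<omega>] Y01[OF draws_component[OF \<omega>]]
      by (intro ennreal_leI bounded_le_one_minus_prod) blast+
  qed (use Y in simp)
  also have "\<dots> = ennreal (LINT \<omega>|draws n M. ?H \<omega>)"
  proof (rule nn_integral_eq_integral)
    show "integrable (draws n M) ?H"
      by (intro Bochner_Integration.integrable_diff \<Omega>.integrable_const prod_int)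
    show "AE \<omega> in draws n M. 0 \<le> ?H \<omega>"
    proof (rule AE_I2)
      fix \<omega> assume \<omega>: "\<omega> \<in> space (draws n M)"
      have "(\<Prod>j\<in>{1..M}. 1 - Y (\<omega> j)) \<le> 1"
        using Y01[OF draws_component[OF \<omega>]] by (intro prod_le_1) auto
      then show "0 \<le> ?H \<omega>" by simp
    qed
  qed
  also have "(LINT \<omega>|draws n M. ?H \<omega>) = 1 - (LINT \<omega>|draws n M. (\<Prod>j\<in>{1..M}. 1 - Y (\<omega> j)))"
    using Bochner_Integration.integral_diff[OF \<Omega>.integrable_const[of 1] prod_int]
    by (simp only: lebesgue_integral_const \<Omega>.prob_space scaleR_one)
  also have "(LINT \<omega>|draws n M. (\<Prod>j\<in>{1..M}. 1 - Y (\<omega> j))) = (\<Prod>j\<in>{1..M}. LINT x|?S. 1 - Y x)"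
    using Zi by (intro P.product_integral_prod) auto
  also have "\<dots> = (1 - (LINT x|?S. Y x)) ^ M"
    using Yi by (simp add: S.prob_space)
  finally show ?thesis .
qed

text \<open>Rescaling to values in \<open>[0, 1]\<close> combines the last bound with Hoelder's inequality. The case
  \<open>B = 0\<close> is separate: there \<open>Y\<close> vanishes.\<close>

lemma best_sample_bounded_expectation:
  fixes Y :: "(nat \<Rightarrow> 'a) \<Rightarrow> real" and \<alpha> \<epsilon> B :: real
  assumes M: "1 \<le> M" and \<epsilon>: "0 < \<epsilon>" "\<epsilon> \<le> 1" and B: "0 \<le> B" and \<alpha>: "0 \<le> \<alpha>"
    and Y: "Y \<in> borel_measurable (sample_space n)"
    and Y0: "\<And>x. 0 \<le> Y x" and YB: "\<And>x. x \<in> space (sample_space n) \<Longrightarrow> Y x \<le> B\<^sup>2"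
    and EY: "(\<integral>\<^sup>+x. ennreal (Y x) \<partial>sample_space n) \<le> ennreal \<alpha>"
  shows "(\<integral>\<^sup>+x. ennreal (Y x) \<partial>best_sample_measure \<mu> \<phi> n M)
    \<le> ennreal (C_const \<epsilon> M * rpow B (2 - 2 * \<epsilon>) * rpow \<alpha> \<epsilon>)"
proof (cases "B = 0")
  case True
  have "(\<integral>\<^sup>+x. ennreal (Y x) \<partial>best_sample_measure \<mu> \<phi> n M) \<le> (\<integral>\<^sup>+x. 0 \<partial>best_sample_measure \<mu> \<phi> n M)"
    using YB True sets_eq_imp_space_eq[OF sets_best_sample[OF M, of n]]
    by (intro nn_integral_mono) (simp add: ennreal_neg)
  then show ?thesis by simp
next
  case False
  then have B: "0 < B" using B by simp
  let ?S = "sample_space n" and ?y = "\<lambda>x. Y x / B\<^sup>2"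
  interpret S: prob_space ?S by (rule prob_space_sample)
  define a where "a = (LINT x|?S. ?y x)"
  have y01: "0 \<le> ?y x \<and> ?y x \<le> 1" if "x \<in> space ?S" for x
    using Y0[of x] YB[OF that] B by simp
  have ym: "?y \<in> borel_measurable ?S" using Y by simp
  have Yi: "integrable ?S Y"
    using Y Y0 YB by (intro S.integrable_const_bound[of _ "B\<^sup>2"]) auto
  have "ennreal (LINT x|?S. Y x) \<le> ennreal \<alpha>"
    using EY Yi Y0 by (simp add: nn_integral_eq_integral)
  then have "(LINT x|?S. Y x) \<le> \<alpha>" using \<alpha> by simp
  then have a_le: "a \<le> \<alpha> / B\<^sup>2" unfolding a_def using B by (simp add: divide_right_mono)
  have a0: "0 \<le> a" unfolding a_def using Y0 by (intro Bochner_Integration.integral_nonneg) simp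
  have a1: "a \<le> 1" unfolding a_def
    using y01 Yi by (intro S.integral_le_const) auto
  have Bpow: "B\<^sup>2 * rpow (\<alpha> / B\<^sup>2) \<epsilon> = rpow B (2 - 2 * \<epsilon>) * rpow \<alpha> \<epsilon>"
  proof -
    have "(B\<^sup>2) powr \<epsilon> = B powr (2 * \<epsilon>)"
      using B by (simp add: powr_powr flip: powr_numeral)
    moreover have "B powr (2 - 2 * \<epsilon>) = B\<^sup>2 / B powr (2 * \<epsilon>)"
      using B by (simp add: powr_diff)
    moreover have "rpow B (2 - 2 * \<epsilon>) = B powr (2 - 2 * \<epsilon>)" using B by (simp add: rpow_def)
    ultimately show ?thesis
      using B \<alpha> \<epsilon> by (simp add: rpow_def powr_divide)
  qed
  have "(\<integral>\<^sup>+x. ennreal (Y x) \<partial>best_sample_measure \<mu> \<phi> n M)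
      = (\<integral>\<^sup>+x. ennreal (B\<^sup>2) * ennreal (?y x) \<partial>best_sample_measure \<mu> \<phi> n M)"
    using B Y0 by (intro nn_integral_cong) (simp add: ennreal_mult[symmetric])
  also have "\<dots> = ennreal (B\<^sup>2) * (\<integral>\<^sup>+x. ennreal (?y x) \<partial>best_sample_measure \<mu> \<phi> n M)"
    using ym by (intro nn_integral_cmult) (simp add: measurable_cong_sets[OF sets_best_sample[OF M] refl])
  also have "\<dots> \<le> ennreal (B\<^sup>2) * ennreal (1 - (1 - a) ^ M)"
    unfolding a_def using y01 by (intro mult_left_mono best_sample_expectation_le_one_minus_power M ym) auto
  also have "\<dots> = ennreal (B\<^sup>2 * (1 - (1 - a) ^ M))"
    using a0 a1 by (subst ennreal_mult) (auto simp: power_le_one)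
  also have "\<dots> \<le> ennreal (C_const \<epsilon> M * rpow B (2 - 2 * \<epsilon>) * rpow \<alpha> \<epsilon>)"
  proof (rule ennreal_leI)
    have "B\<^sup>2 * (1 - (1 - a) ^ M) \<le> B\<^sup>2 * (C_const \<epsilon> M * rpow a \<epsilon>)"
      by (intro mult_left_mono one_minus_power_le_C_const a0 a1 \<epsilon> M) simp
    also have "\<dots> \<le> B\<^sup>2 * (C_const \<epsilon> M * rpow (\<alpha> / B\<^sup>2) \<epsilon>)"
      using \<epsilon> a0 a_le by (intro mult_left_mono C_const_nonneg) (auto simp: rpow_def intro: powr_mono2)
    also have "\<dots> = C_const \<epsilon> M * (B\<^sup>2 * rpow (\<alpha> / B\<^sup>2) \<epsilon>)" by (simp only: mult_ac)
    also have "\<dots> = C_const \<epsilon> M * rpow B (2 - 2 * \<epsilon>) * rpow \<alpha> \<epsilon>" unfolding Bpow by (simp only: mult_ac)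
    finally show "B\<^sup>2 * (1 - (1 - a) ^ M) \<le> C_const \<epsilon> M * rpow B (2 - 2 * \<epsilon>) * rpow \<alpha> \<epsilon>" .
  qed
  finally show ?thesis .
qed

section \<open>The weighted supremum norm\<close>

lemma wsup_norm_le_iff:
  "wsup_norm \<mu> \<phi> v \<le> ereal L \<longleftrightarrow> (\<forall>x\<in>space \<mu>. sqrt (weight \<phi> x) * \<bar>v x\<bar> \<le> L)"
  by (simp add: wsup_norm_def SUP_le_iff)

lemma proj_coeffs_inner:
  assumes v: "v \<in> L2 \<mu>"
  shows "proj_coeffs v \<bullet> c = (LINT x|\<mu>. v x * (feature \<phi> x \<bullet> c))"
proof -
  have "v x * (feature \<phi> x \<bullet> c) = (\<Sum>j\<in>UNIV. c $ j * (v x * \<phi> j x))" for x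
    by (simp add: feature_inner sum_distrib_left mult_ac)
  then show ?thesis
    using L2_product_integrable[OF v basis_L2]
    by (simp add: Bochner_Integration.integral_sum proj_coeffs_def inner_vec_def L2_inner_def mult.commute)
qed

text \<open>On the set where the weight vanishes the features vanish too, so the values of \<open>v\<close> there,
  which the weighted norm does not control, do not enter the coefficients.\<close>

lemma proj_coeffs_norm_le_1:
  assumes v: "v \<in> L2 \<mu>" and le: "wsup_norm \<mu> \<phi> v \<le> 1"
  shows "norm (proj_coeffs v) \<le> 1"
proof -
  let ?p = "proj_coeffs v"
  have point: "v x * (feature \<phi> x \<bullet> ?p) \<le> (inv_weight \<phi> x + (feature \<phi> x \<bullet> ?p)\<^sup>2) / 2" if x: "x \<in> space \<mu>" for x
  proof (cases "feature \<phi> x = 0")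
    case False
    then have w: "0 < inv_weight \<phi> x" "weight \<phi> x = 1 / inv_weight \<phi> x"
      by (auto simp: inv_weight_eq weight_eq)
    have "sqrt (weight \<phi> x) * \<bar>v x\<bar> \<le> 1" using le x wsup_norm_le_iff[of v 1] by (simp add: one_ereal_def)
    then have "(sqrt (weight \<phi> x) * \<bar>v x\<bar>)\<^sup>2 \<le> 1"
      by (intro power_le_one) (simp_all add: weight_nonneg)
    then have "(v x)\<^sup>2 \<le> inv_weight \<phi> x"
      using w by (simp add: power_mult_distrib field_simps)
    then show ?thesis
      using sum_squares_bound[of "v x" "feature \<phi> x \<bullet> ?p"] by simp
  qed (simp add: inv_weight_nonneg)
  \<comment> \<open>The norm of the coefficients occurs on both sides; half of it is absorbed on the left.\<close>
  have "(norm ?p)\<^sup>2 = (LINT x|\<mu>. v x * (feature \<phi> x \<bullet> ?p))"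
    unfolding power2_norm_eq_inner by (rule proj_coeffs_inner[OF v])
  also have "\<dots> \<le> (LINT x|\<mu>. (inv_weight \<phi> x + (feature \<phi> x \<bullet> ?p)\<^sup>2) / 2)"
    using L2_product_integrable[OF v lincomb_L2] inv_weight_integral feature_inner_square point
    by (intro integral_mono) auto
  also have "\<dots> = (1 + (norm ?p)\<^sup>2) / 2"
    using inv_weight_integral feature_inner_square[of ?p] by simp
  finally have "(norm ?p)\<^sup>2 \<le> 1" by simp
  then show ?thesis by (simp add: power_le_one_iff)
qed

lemma wsup_norm_lincomb: "wsup_norm \<mu> \<phi> (lincomb \<phi> c) \<le> ereal (sqrt (real CARD('m)) * norm c)"
  unfolding wsup_norm_le_iff
proof
  fix x
  have "sqrt (weight \<phi> x) * \<bar>feature \<phi> x \<bullet> c\<bar> \<le> sqrt (weight \<phi> x) * (norm (feature \<phi> x) * norm c)"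
    by (intro mult_left_mono Cauchy_Schwarz_ineq2) (simp add: weight_nonneg)
  also have "\<dots> \<le> sqrt (real CARD('m)) * norm c"
    by (cases "feature \<phi> x = 0") (simp_all add: weight_eq real_sqrt_divide)
  finally show "sqrt (weight \<phi> x) * \<bar>feature \<phi> x \<bullet> c\<bar> \<le> sqrt (real CARD('m)) * norm c" .
qed

text \<open>The supremum defining the constant lies between \<open>0\<close> and \<open>sqrt m\<close>, so it is the real number that
  \<open>real_of_ereal\<close> returns.\<close>

lemma proj_const_bound:
  shows "0 \<le> proj_const \<mu> \<phi>"
    and "\<And>v. v \<in> L2 \<mu> \<Longrightarrow> wsup_norm \<mu> \<phi> v \<le> 1 \<Longrightarrow> wsup_norm \<mu> \<phi> (L2_proj \<mu> \<phi> v) \<le> ereal (proj_const \<mu> \<phi>)"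
proof -
  let ?A = "{v \<in> L2 \<mu>. wsup_norm \<mu> \<phi> v \<le> 1}"
  define s where "s = (SUP v\<in>?A. wsup_norm \<mu> \<phi> (L2_proj \<mu> \<phi> v))"
  have upper: "s \<le> ereal (sqrt (real CARD('m)))"
    unfolding s_def
  proof (rule SUP_least)
    fix v assume "v \<in> ?A"
    then have "norm (proj_coeffs v) \<le> 1" by (intro proj_coeffs_norm_le_1) auto
    then have "sqrt (real CARD('m)) * norm (proj_coeffs v) \<le> sqrt (real CARD('m))"
      by (simp add: mult_left_le)
    then show "wsup_norm \<mu> \<phi> (L2_proj \<mu> \<phi> v) \<le> ereal (sqrt (real CARD('m)))"
      unfolding L2_proj_eq using wsup_norm_lincomb[of "proj_coeffs v"] by (meson ereal_less_eq(3) order_trans)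
  qed
  have zero: "(\<lambda>_. 0) \<in> ?A" using not_empty by (simp add: L2_def wsup_norm_def zero_ereal_def[symmetric])
  have "wsup_norm \<mu> \<phi> (L2_proj \<mu> \<phi> (\<lambda>_. 0)) = 0"
    using not_empty by (simp add: L2_proj_def L2_inner_def wsup_norm_def zero_ereal_def[symmetric])
  then have lower: "0 \<le> s" unfolding s_def using SUP_upper[OF zero] by (metis (no_types, lifting))
  have s: "s = ereal (proj_const \<mu> \<phi>)"
    using upper lower unfolding proj_const_def s_def[symmetric] by (cases s) auto
  show "0 \<le> proj_const \<mu> \<phi>" using lower s by simp
  show "wsup_norm \<mu> \<phi> (L2_proj \<mu> \<phi> v) \<le> ereal (proj_const \<mu> \<phi>)"
    if "v \<in> L2 \<mu>" "wsup_norm \<mu> \<phi> v \<le> 1" for v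
    unfolding s[symmetric] s_def using that by (intro SUP_upper) simp
qed

text \<open>By homogeneity for \<open>L > 0\<close>. For \<open>L = 0\<close> rescaling is impossible, but then \<open>u\<close> vanishes wherever
  some feature does not, and its projection is zero.\<close>

lemma L2_proj_wsup_bound:
  assumes u: "u \<in> L2 \<mu>" and le: "wsup_norm \<mu> \<phi> u \<le> ereal L" and x: "x \<in> space \<mu>"
  shows "sqrt (weight \<phi> x) * \<bar>L2_proj \<mu> \<phi> u x\<bar> \<le> proj_const \<mu> \<phi> * L"
proof -
  have pt: "sqrt (weight \<phi> y) * \<bar>u y\<bar> \<le> L" if "y \<in> space \<mu>" for y
    using le that by (simp add: wsup_norm_le_iff)
  have "0 \<le> sqrt (weight \<phi> x) * \<bar>u x\<bar>" by (simp add: weight_nonneg)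
  then have "0 \<le> L" using pt[OF x] by linarith
  show ?thesis
  proof (cases "L = 0")
    case True
    have "u y * \<phi> j y = 0" if "y \<in> space \<mu>" for y j
    proof (cases "feature \<phi> y = 0")
      case True
      then have "feature \<phi> y $ j = 0" by simp
      then show ?thesis by (simp add: feature_def)
    next
      case False
      then have "0 < sqrt (weight \<phi> y)" by (simp add: weight_eq)
      moreover have "sqrt (weight \<phi> y) * \<bar>u y\<bar> \<le> 0" using pt[OF that] \<open>L = 0\<close> by simp
      ultimately have "\<bar>u y\<bar> \<le> 0" by (simp add: mult_le_0_iff)
      then show ?thesis by simp
    qed
    then have "L2_inner \<mu> u (\<phi> j) = 0" for j
      unfolding L2_inner_def by (subst Bochner_Integration.integral_cong[OF refl, of _ _ "\<lambda>_. 0"]) auto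
    then show ?thesis using True by (simp add: L2_proj_def)
  next
    case False
    with \<open>0 \<le> L\<close> have L: "0 < L" by simp
    let ?v = "\<lambda>t. u t / L"
    have "?v \<in> L2 \<mu>" using u by (auto simp: L2_def power_divide)
    moreover have "wsup_norm \<mu> \<phi> ?v \<le> 1"
      using pt L by (simp add: one_ereal_def wsup_norm_le_iff)
    ultimately have "sqrt (weight \<phi> x) * \<bar>L2_proj \<mu> \<phi> ?v x\<bar> \<le> proj_const \<mu> \<phi>"
      using proj_const_bound(2)[of ?v] x by (simp add: wsup_norm_le_iff)
    moreover have "L2_proj \<mu> \<phi> ?v x = L2_proj \<mu> \<phi> u x / L"
      by (simp add: L2_proj_def L2_inner_def sum_divide_distrib)
    ultimately show ?thesis using L by (simp add: field_simps)
  qed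
qed

lemma residual_emp_inner_bound:
  assumes u: "u \<in> L2 \<mu>" and le: "wsup_norm \<mu> \<phi> u \<le> ereal L"
    and x: "x \<in> space (sample_space n)" and n: "0 < n"
  shows "0 \<le> L * (1 + proj_const \<mu> \<phi>)"
    and "emp_inner \<phi> n x (residual u) (residual u) \<le> (L * (1 + proj_const \<mu> \<phi>))\<^sup>2"
proof -
  let ?B = "L * (1 + proj_const \<mu> \<phi>)" and ?g = "residual u"
  have pt: "0 \<le> sqrt (weight \<phi> y) * \<bar>?g y\<bar>" "sqrt (weight \<phi> y) * \<bar>?g y\<bar> \<le> ?B" if y: "y \<in> space \<mu>" for y
  proof -
    show "0 \<le> sqrt (weight \<phi> y) * \<bar>?g y\<bar>" by (simp add: weight_nonneg)
    have "sqrt (weight \<phi> y) * \<bar>?g y\<bar> \<le> sqrt (weight \<phi> y) * (\<bar>u y\<bar> + \<bar>L2_proj \<mu> \<phi> u y\<bar>)"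
      by (intro mult_left_mono abs_triangle_ineq4) (simp add: weight_nonneg)
    also have "\<dots> \<le> L + proj_const \<mu> \<phi> * L"
      unfolding distrib_left using le y
      by (intro add_mono L2_proj_wsup_bound[OF u le y]) (simp add: wsup_norm_le_iff)
    finally show "sqrt (weight \<phi> y) * \<bar>?g y\<bar> \<le> ?B" by (simp add: algebra_simps)
  qed
  have xi: "x i \<in> space \<mu>" if "i \<in> {1..n}" for i
    using x that by (auto simp: sample_measure_def space_PiM)
  have "1 \<in> {1..n}" using n by simp
  from pt[OF xi[OF this]] show "0 \<le> ?B" by linarith
  have sq: "weight \<phi> (x i) * ?g (x i) * ?g (x i) \<le> ?B\<^sup>2" if "i \<in> {1..n}" for i
  proof -
    have "(sqrt (weight \<phi> (x i)) * \<bar>?g (x i)\<bar>)\<^sup>2 \<le> ?B\<^sup>2"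
      using pt[OF xi[OF that]] by (intro power_mono)
    moreover have "(sqrt (weight \<phi> (x i)) * \<bar>?g (x i)\<bar>)\<^sup>2 = weight \<phi> (x i) * ?g (x i) * ?g (x i)"
      unfolding power_mult_distrib power2_abs real_sqrt_pow2[OF weight_nonneg] by (simp add: power2_eq_square)
    ultimately show ?thesis by simp
  qed
  have "(\<Sum>i=1..n. weight \<phi> (x i) * ?g (x i) * ?g (x i)) \<le> (\<Sum>i=1..n. ?B\<^sup>2)"
    by (intro sum_mono sq)
  then show "emp_inner \<phi> n x ?g ?g \<le> ?B\<^sup>2"
    using n by (simp add: emp_inner_def divide_le_eq mult.commute)
qed

end

section \<open>The error bound\<close>

theorem theorem3p6:
  fixes X :: "(real^'d) set"
    and \<mu> :: "(real^'d) measure"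
    and \<phi> :: "'m::finite \<Rightarrow> real^'d \<Rightarrow> real"
    and u :: "real^'d \<Rightarrow> real"
    and M n :: nat
    and \<delta> \<eta> :: real
  assumes "prob_space \<mu>" and "space \<mu> = X"
    and "L2_orthonormal \<mu> \<phi>"
    and "u \<in> L2 \<mu>"
    and "M \<ge> 1"
    and "0 < \<delta>" and "\<delta> < 1"
    and "0 < \<eta>" and "\<eta> < 1"
    and "real n \<ge> inverse (d_const \<delta>) * real CARD('m) * ln (2 * real CARD('m) * inverse \<eta>)"
  shows
    "(\<integral>\<^sup>+ x. ennreal ((L2_norm \<mu> (\<lambda>t. u t - ls_proj \<phi> n x u t))\<^sup>2)
         \<partial>stable_sample_measure \<mu> \<phi> n M \<delta>)
       \<le> ennreal ((1 + inverse (1 - \<delta>) * inverse (1 - \<eta> ^ M) * real M)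
           * (L2_norm \<mu> (\<lambda>t. u t - L2_proj \<mu> \<phi> u t))\<^sup>2)
     \<and> (\<forall>L::real. wsup_norm \<mu> \<phi> u \<le> ereal L \<longrightarrow>
       (\<integral>\<^sup>+ x. ennreal ((L2_norm \<mu> (\<lambda>t. u t - ls_proj \<phi> n x u t))\<^sup>2)
           \<partial>stable_sample_measure \<mu> \<phi> n M \<delta>)
         \<le> ennreal ((L2_norm \<mu> (\<lambda>t. u t - L2_proj \<mu> \<phi> u t))\<^sup>2
             + inverse (1 - \<delta>) * inverse (1 - \<eta> ^ M)
               * D_const M L (proj_const \<mu> \<phi>)
                   ((L2_norm \<mu> (\<lambda>t. u t - L2_proj \<mu> \<phi> u t))\<^sup>2)))"
proof -
  note M = \<open>M \<ge> 1\<close> and u = \<open>u \<in> L2 \<mu>\<close>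
  interpret L2_orthonormal_system \<mu> \<phi>
    using assms(1,3) by (intro L2_orthonormal_system.intro L2_orthonormal_system_axioms.intro)
  note n = enough_samples_stability[OF assms(6-10)]
  let ?N = "best_sample_measure \<mu> \<phi> n M" and ?g = "residual u"
  let ?Y = "\<lambda>x. emp_inner \<phi> n x ?g ?g" and ?\<alpha> = "(L2_norm \<mu> ?g)\<^sup>2"
  let ?E = "\<integral>\<^sup>+ x. ennreal ((L2_norm \<mu> (\<lambda>t. u t - ls_proj \<phi> n x u t))\<^sup>2) \<partial>stable_sample_measure \<mu> \<phi> n M \<delta>"
  have g: "?g \<in> L2 \<mu>" by (rule residual_L2[OF u])
  then have Ym: "?Y \<in> borel_measurable (sample_space n)"
    by (intro emp_inner_measurable) (simp add: L2_def)
  note EY = emp_inner_expectation[OF g n(1)]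
  have p: "0 < 1 - \<eta> ^ M" using assms(5,8,9) by (simp add: power_less_one_iff)
  have stable: "ennreal (1 - \<eta> ^ M) \<le> emeasure ?N (stable_event n \<delta>)"
    using assms(8) by (intro best_sample_stable_probability M n(2)) simp
  have bound: "?E \<le> ennreal (?\<alpha> + inverse (1 - \<delta>) * inverse (1 - \<eta> ^ M) * e)"
    if "(\<integral>\<^sup>+x. ennreal (?Y x) \<partial>?N) \<le> ennreal e" "0 \<le> e" for e
    using that assms(7)
    by (intro stable_expectation_le[OF M p stable Ym emp_inner_nonneg] ls_proj_error[OF u]) auto
  have first: "(\<integral>\<^sup>+x. ennreal (?Y x) \<partial>?N) \<le> ennreal (real M * ?\<alpha>)"
  proof -
    have "(\<integral>\<^sup>+x. ennreal (?Y x) \<partial>?N) \<le> of_nat M * (\<integral>\<^sup>+x. ennreal (?Y x) \<partial>sample_space n)"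
      using Ym by (intro best_sample_expectation_le_sum M) simp
    also have "\<dots> \<le> of_nat M * ennreal ?\<alpha>" by (intro mult_left_mono EY) simp
    finally show ?thesis by (simp add: ennreal_of_nat_eq_real_of_nat ennreal_mult)
  qed
  have "?E \<le> ennreal ((1 + inverse (1 - \<delta>) * inverse (1 - \<eta> ^ M) * real M) * ?\<alpha>)"
    using bound[OF first] by (simp add: algebra_simps)
  moreover have "?E \<le> ennreal (?\<alpha> + inverse (1 - \<delta>) * inverse (1 - \<eta> ^ M) * D_const M L (proj_const \<mu> \<phi>) ?\<alpha>)"
    if L: "wsup_norm \<mu> \<phi> u \<le> ereal L" for L
  proof (rule bound)
    let ?B = "L * (1 + proj_const \<mu> \<phi>)"
    let ?T = "\<lambda>\<epsilon>. C_const \<epsilon> M * rpow ?B (2 - 2 * \<epsilon>) * rpow ?\<alpha> \<epsilon>"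
    \<comment> \<open>The first bound makes the expectation a real number, to be compared with each term of the infimum.\<close>
    obtain r where r: "0 \<le> r" "(\<integral>\<^sup>+x. ennreal (?Y x) \<partial>?N) = ennreal r"
      using first by (cases "\<integral>\<^sup>+x. ennreal (?Y x) \<partial>?N" rule: ennreal_cases) (auto simp: top_unique)
    obtain x0 where "x0 \<in> space (sample_space n)"
      using prob_space.not_empty[OF prob_space_sample[of n]] by blast
    note B0 = residual_emp_inner_bound(1)[OF u L this n(1)]
    have "r \<le> ?T \<epsilon>" if \<epsilon>: "\<epsilon> \<in> {0<..1}" for \<epsilon>
    proof -
      have "ennreal r \<le> ennreal (?T \<epsilon>)"
        unfolding r(2)[symmetric] using \<epsilon>
        by (intro best_sample_bounded_expectation M B0 Ym emp_inner_nonneg EY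
            residual_emp_inner_bound(2)[OF u L _ n(1)]) auto
      moreover have "0 \<le> ?T \<epsilon>" using \<epsilon> by (intro mult_nonneg_nonneg C_const_nonneg rpow_nonneg) auto
      ultimately show ?thesis by simp
    qed
    then have "r \<le> D_const M L (proj_const \<mu> \<phi>) ?\<alpha>"
      unfolding D_const_def by (intro cINF_greatest) auto
    with r show "(\<integral>\<^sup>+x. ennreal (?Y x) \<partial>?N) \<le> ennreal (D_const M L (proj_const \<mu> \<phi>) ?\<alpha>)"
      and "0 \<le> D_const M L (proj_const \<mu> \<phi>) ?\<alpha>"
      by (auto intro: ennreal_leI)
  qed
  ultimately show ?thesis by blast
qed

end
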